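(* Let $G$ and $H$ be topological abelian groups. Suppose that $H$ is divisible and that $A$ is an open subgroup of $G$. Then $\mathrm{Ext}(G,H)\cong\mathrm{Ext}(A,H)$ (isomorphism of abelian groups).
   Context: All topological groups are Hausdorff and abelian. An extension of topological abelian groups is a short exact sequence $E:0\to H\stackrel{\imath}{\to}X\stackrel{\pi}{\to}G\to 0$ of topological abelian groups in which $\imath,\pi$ are continuous homomorphisms that are open onto their images. Two extensions $0\to H\stackrel{\imath}{\to}X\stackrel{\pi}{\to}G\to 0$ and $0\to H\stackrel{\imath'}{\to}X'\stackrel{\pi'}{\to}G\to 0$ are equivalent if there is a continuous homomorphism $T:X\to X'$ with $T\circ\imath=\imath'$ and $\pi'\circ T=\pi$ (such a $T$ is necessarily a topological isomorphism). $\mathrm{Ext}(G,H)$ is the set of equivalence classes of such extensions. It is an abelian group under the Baer sum: $[E_1]+[E_2]$ is the class of the extension obtained from the product extension $0\to H\times H\to X_1\times X_2\to G\times G\to 0$ by pulling back along the diagonal $G\to G\times G$ and then pushing out along the addition map $H\times H\to H$ (pull-backs and push-outs taken in topological abelian groups). The zero element is the class of the trivial extension $0\to H\to H\times G\to G\to 0$. *)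

theory Defs
  imports "HOL-Algebra.Coset" "HOL-Analysis.T1_Spaces"
begin

section \<open>Topological abelian groups\<close>

text \<open>Groups are written multiplicatively, as in HOL-Algebra, and all structure is relative to
  explicit carriers.\<close>

record 'a top_group = "'a monoid" +
  topol :: "'a topology"

definition with_topology :: "('a, 'm) monoid_scheme \<Rightarrow> 'a topology \<Rightarrow> 'a top_group" where
  "with_topology M T = \<lparr>carrier = carrier M, mult = mult M, one = one M, topol = T\<rparr>"

lemma with_topology_simps [simp]:
  "carrier (with_topology M T) = carrier M"
  "mult (with_topology M T) = mult M"
  "one (with_topology M T) = one M"
  "topol (with_topology M T) = T"
  by (simp_all add: with_topology_def)

definition top_ab_group :: "'a top_group \<Rightarrow> bool" where
  "top_ab_group G \<longleftrightarrow>
     comm_group G \<and>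
     topspace (topol G) = carrier G \<and>
     Hausdorff_space (topol G) \<and>
     continuous_map (prod_topology (topol G) (topol G)) (topol G) (\<lambda>(x, y). x \<otimes>\<^bsub>G\<^esub> y) \<and>
     continuous_map (topol G) (topol G) (\<lambda>x. inv\<^bsub>G\<^esub> x)"

definition cont_hom :: "'a top_group \<Rightarrow> 'b top_group \<Rightarrow> ('a \<Rightarrow> 'b) set" where
  "cont_hom G K = {f \<in> hom G K. continuous_map (topol G) (topol K) f}"

definition divisible_group :: "('a, 'm) monoid_scheme \<Rightarrow> bool" where
  "divisible_group H \<longleftrightarrow>
     (\<forall>n::nat. n > 0 \<longrightarrow> (\<forall>x \<in> carrier H. \<exists>y \<in> carrier H. y [^]\<^bsub>H\<^esub> n = x))"

definition top_subgroup :: "'a top_group \<Rightarrow> 'a set \<Rightarrow> 'a top_group" where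
  "top_subgroup G A = with_topology (G\<lparr>carrier := A\<rparr>) (subtopology (topol G) A)"

definition top_prod :: "'a top_group \<Rightarrow> 'b top_group \<Rightarrow> ('a \<times> 'b) top_group" where
  "top_prod G K = with_topology (G \<times>\<times> K) (prod_topology (topol G) (topol K))"

text \<open>The finest topology on the image of \<open>q\<close> that makes \<open>q\<close> continuous.\<close>

definition quotient_topology :: "'a topology \<Rightarrow> ('a \<Rightarrow> 'b) \<Rightarrow> 'b topology" where
  "quotient_topology T q =
     topology (\<lambda>V. V \<subseteq> q ` topspace T \<and> openin T {x \<in> topspace T. q x \<in> V})"

lemma openin_quotient_topology:
  "openin (quotient_topology T q) V \<longleftrightarrow>
     V \<subseteq> q ` topspace T \<and> openin T {x \<in> topspace T. q x \<in> V}"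
proof -
  have "istopology (\<lambda>V. V \<subseteq> q ` topspace T \<and> openin T {x \<in> topspace T. q x \<in> V})"
    unfolding istopology_def
  proof (rule conjI; intro allI impI conjI)
    fix S U
    assume "S \<subseteq> q ` topspace T \<and> openin T {x \<in> topspace T. q x \<in> S}"
      and "U \<subseteq> q ` topspace T \<and> openin T {x \<in> topspace T. q x \<in> U}"
    then have "openin T ({x \<in> topspace T. q x \<in> S} \<inter> {x \<in> topspace T. q x \<in> U})"
      by blast
    also have "{x \<in> topspace T. q x \<in> S} \<inter> {x \<in> topspace T. q x \<in> U}
        = {x \<in> topspace T. q x \<in> S \<inter> U}" by auto
    finally show "openin T {x \<in> topspace T. q x \<in> S \<inter> U}" .
  next
    fix K
    assume K: "\<forall>S\<in>K. S \<subseteq> q ` topspace T \<and> openin T {x \<in> topspace T. q x \<in> S}"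
    then have "openin T (\<Union>S\<in>K. {x \<in> topspace T. q x \<in> S})" by blast
    also have "(\<Union>S\<in>K. {x \<in> topspace T. q x \<in> S}) = {x \<in> topspace T. q x \<in> \<Union>K}" by auto
    finally show "openin T {x \<in> topspace T. q x \<in> \<Union>K}" .
  qed blast+
  then show ?thesis by (simp add: quotient_topology_def)
qed

lemma topspace_quotient_topology [simp]:
  "topspace (quotient_topology T q) = q ` topspace T"
proof -
  have "{x \<in> topspace T. q x \<in> q ` topspace T} = topspace T" by auto
  then have "openin (quotient_topology T q) (q ` topspace T)"
    by (simp add: openin_quotient_topology)
  then show ?thesis
    by (meson openin_quotient_topology openin_subset openin_topspace subset_antisym)
qed

lemma quotient_map_quotient_topology: "quotient_map T (quotient_topology T q) q"
  by (simp add: quotient_map_def openin_quotient_topology)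

definition top_quotient :: "'a top_group \<Rightarrow> 'a set \<Rightarrow> 'a set top_group" where
  "top_quotient G N =
     with_topology (G Mod N) (quotient_topology (topol G) (\<lambda>x. N #>\<^bsub>G\<^esub> x))"

section \<open>Extensions\<close>

record ('h, 'x, 'g) extension =
  mid :: "'x top_group"
  inc :: "'h \<Rightarrow> 'x"
  prj :: "'x \<Rightarrow> 'g"

definition open_onto_image :: "'a top_group \<Rightarrow> 'b top_group \<Rightarrow> ('a \<Rightarrow> 'b) \<Rightarrow> bool" where
  "open_onto_image G K f \<longleftrightarrow>
     open_map (topol G) (subtopology (topol K) (f ` carrier G)) f"

definition is_extension ::
    "'g top_group \<Rightarrow> 'h top_group \<Rightarrow> ('h, 'x, 'g) extension \<Rightarrow> bool" where
  "is_extension G H E \<longleftrightarrow>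
     top_ab_group (mid E) \<and>
     inc E \<in> cont_hom H (mid E) \<and>
     prj E \<in> cont_hom (mid E) G \<and>
     inj_on (inc E) (carrier H) \<and>
     inc E ` carrier H = kernel (mid E) G (prj E) \<and>
     prj E ` carrier (mid E) = carrier G \<and>
     open_onto_image H (mid E) (inc E) \<and>
     open_onto_image (mid E) G (prj E)"

text \<open>The two middle groups may live in different types. As HOL functions are total, the
  triangles are required to commute on the carriers only.\<close>

definition ext_equiv ::
    "'h top_group \<Rightarrow> ('h, 'x, 'g) extension \<Rightarrow> ('h, 'y, 'g) extension \<Rightarrow> bool" where
  "ext_equiv H E E' \<longleftrightarrow>
     (\<exists>T \<in> cont_hom (mid E) (mid E').
        (\<forall>h \<in> carrier H. T (inc E h) = inc E' h) \<and>
        (\<forall>x \<in> carrier (mid E). prj E' (T x) = prj E x))"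

definition trivial_extension ::
    "'g top_group \<Rightarrow> 'h top_group \<Rightarrow> ('h, 'h \<times> 'g, 'g) extension" where
  "trivial_extension G H =
     \<lparr>mid = top_prod H G, inc = (\<lambda>h. (h, \<one>\<^bsub>G\<^esub>)), prj = snd\<rparr>"

definition ext_prod ::
    "('h1, 'x1, 'g1) extension \<Rightarrow> ('h2, 'x2, 'g2) extension \<Rightarrow>
     ('h1 \<times> 'h2, 'x1 \<times> 'x2, 'g1 \<times> 'g2) extension" where
  "ext_prod E1 E2 =
     \<lparr>mid = top_prod (mid E1) (mid E2),
      inc = map_prod (inc E1) (inc E2),
      prj = map_prod (prj E1) (prj E2)\<rparr>"

text \<open>Pull-back of an extension of \<open>G\<close> along \<open>t : G' \<rightarrow> G\<close>.\<close>

definition ext_pullback ::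
    "'g2 top_group \<Rightarrow> ('g2 \<Rightarrow> 'g) \<Rightarrow> ('h, 'x, 'g) extension \<Rightarrow> ('h, 'x \<times> 'g2, 'g2) extension" where
  "ext_pullback G' t E =
     \<lparr>mid = top_subgroup (top_prod (mid E) G')
              {(x, g). x \<in> carrier (mid E) \<and> g \<in> carrier G' \<and> prj E x = t g},
      inc = (\<lambda>h. (inc E h, \<one>\<^bsub>G'\<^esub>)),
      prj = snd\<rparr>"

text \<open>Push-out along \<open>t : H \<rightarrow> H'\<close> of an extension by \<open>H\<close> with middle group \<open>X\<close>: the quotient of
  \<open>H' \<times> X\<close> by the subgroup of all \<open>(t h, (inc h)\<inverse>)\<close>. That subgroup is closed because
  \<open>inc\<close> is an embedding with closed image, so this quotient is already Hausdorff. The projection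
  sends the class of \<open>(k, x)\<close> to \<open>prj x\<close>; it is written with a choice of representative.\<close>

definition pushout_kernel ::
    "'h top_group \<Rightarrow> ('h \<Rightarrow> 'k) \<Rightarrow> ('h, 'x, 'g) extension \<Rightarrow> ('k \<times> 'x) set" where
  "pushout_kernel H t E = (\<lambda>h. (t h, inv\<^bsub>mid E\<^esub> (inc E h))) ` carrier H"

definition ext_pushout ::
    "'h top_group \<Rightarrow> 'k top_group \<Rightarrow> ('h \<Rightarrow> 'k) \<Rightarrow> ('h, 'x, 'g) extension \<Rightarrow>
     ('k, ('k \<times> 'x) set, 'g) extension" where
  "ext_pushout H H' t E =
     (let P = top_prod H' (mid E); N = pushout_kernel H t E in
      \<lparr>mid = top_quotient P N,
       inc = (\<lambda>k. N #>\<^bsub>P\<^esub> (k, \<one>\<^bsub>mid E\<^esub>)),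
       prj = (\<lambda>C. prj E (snd (SOME p. p \<in> C)))\<rparr>)"

definition baer_sum ::
    "'g top_group \<Rightarrow> 'h top_group \<Rightarrow> ('h, 'x, 'g) extension \<Rightarrow> ('h, 'y, 'g) extension \<Rightarrow>
     ('h, ('h \<times> ('x \<times> 'y) \<times> 'g) set, 'g) extension" where
  "baer_sum G H E1 E2 =
     ext_pushout (top_prod H H) H (\<lambda>(h, k). h \<otimes>\<^bsub>H\<^esub> k)
       (ext_pullback G (\<lambda>g. (g, g)) (ext_prod E1 E2))"

section \<open>The group of extensions\<close>

text \<open>Since a HOL set ranges over a single type, the members of the equivalence classes have
  middle groups carried by subsets of \<open>'h \<times> 'g\<close>. This loses nothing: by the lemma
  \<open>extension_representative\<close> below, an extension whose middle group lives in any type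
  whatsoever is equivalent to one of these.\<close>

type_synonym ('h, 'g) ext = "('h, 'h \<times> 'g, 'g) extension"

definition ext_class ::
    "'g top_group \<Rightarrow> 'h top_group \<Rightarrow> ('h, 'x, 'g) extension \<Rightarrow> ('h, 'g) ext set" where
  "ext_class G H E = {E'. is_extension G H E' \<and> ext_equiv H E E'}"

text \<open>The product is the usual lifting to classes: the union runs over equal sets.\<close>

definition Ext :: "'g top_group \<Rightarrow> 'h top_group \<Rightarrow> ('h, 'g) ext set monoid" where
  "Ext G H =
     \<lparr>carrier = {ext_class G H E | E :: ('h, 'g) ext. is_extension G H E},
      mult = (\<lambda>C D. \<Union>E1\<in>C. \<Union>E2\<in>D. ext_class G H (baer_sum G H E1 E2)),
      one = ext_class G H (trivial_extension G H)\<rparr>"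

lemma extension_representative:
  fixes E :: "('h, 'x, 'g) extension"
  assumes G: "top_ab_group G" and H: "top_ab_group H" and E: "is_extension G H E"
  shows "\<exists>E' :: ('h, 'g) ext. is_extension G H E' \<and> ext_equiv H E E' \<and> ext_equiv H E' E"
proof -
  define X where "X = mid E"
  define i where "i = inc E"
  define p where "p = prj E"
  have X: "top_ab_group X" and ih: "i \<in> cont_hom H X" and ph: "p \<in> cont_hom X G"
    and inj: "inj_on i (carrier H)" and ex: "i ` carrier H = kernel X G p"
    and sur: "p ` carrier X = carrier G"
    and oi: "open_onto_image H X i" and op: "open_onto_image X G p"
    using E by (auto simp: is_extension_def X_def i_def p_def)
  interpret X: comm_group X using X by (simp add: top_ab_group_def)
  interpret G: comm_group G using G by (simp add: top_ab_group_def)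
  interpret H: comm_group H using H by (simp add: top_ab_group_def)
  interpret p: group_hom X G p
    using ph by unfold_locales (simp add: cont_hom_def)
  have tX: "topspace (topol X) = carrier X" and tG: "topspace (topol G) = carrier G"
    and tH: "topspace (topol H) = carrier H"
    using X G H by (simp_all add: top_ab_group_def)
  define s where "s = inv_into (carrier X) p"
  have s: "s g \<in> carrier X" "p (s g) = g" if "g \<in> carrier G" for g
    using that sur by (auto simp: s_def inv_into_into f_inv_into_f)
  define f where "f = (\<lambda>x. (inv_into (carrier H) i (x \<otimes>\<^bsub>X\<^esub> inv\<^bsub>X\<^esub> s (p x)), p x))"
  have injf: "inj_on f (carrier X)"
  proof (rule inj_onI)
    fix x y assume x: "x \<in> carrier X" and y: "y \<in> carrier X" and "f x = f y"
    then have pxy: "p x = p y" by (simp add: f_def)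
    with \<open>f x = f y\<close> have
      *: "inv_into (carrier H) i (x \<otimes>\<^bsub>X\<^esub> inv\<^bsub>X\<^esub> s (p x)) =
          inv_into (carrier H) i (y \<otimes>\<^bsub>X\<^esub> inv\<^bsub>X\<^esub> s (p x))"
      by (simp add: f_def)
    have "p (z \<otimes>\<^bsub>X\<^esub> inv\<^bsub>X\<^esub> s (p z)) = \<one>\<^bsub>G\<^esub>" if "z \<in> carrier X" for z
      using that s by simp
    then have "z \<otimes>\<^bsub>X\<^esub> inv\<^bsub>X\<^esub> s (p z) \<in> i ` carrier H" if "z \<in> carrier X" for z
      unfolding ex using that s by (auto simp: kernel_def)
    then have "x \<otimes>\<^bsub>X\<^esub> inv\<^bsub>X\<^esub> s (p x) = y \<otimes>\<^bsub>X\<^esub> inv\<^bsub>X\<^esub> s (p x)"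
      using * x y pxy by (metis inv_into_injective)
    then show "x = y"
      using x y s by (metis X.inv_closed X.right_cancel p.hom_closed)
  qed
  define g where "g = inv_into (carrier X) f"
  have gf: "g (f x) = x" if "x \<in> carrier X" for x
    using that injf by (simp add: g_def)
  define M where "M = \<lparr>carrier = f ` carrier X, mult = (\<lambda>a b. f (g a \<otimes>\<^bsub>X\<^esub> g b)), one = f \<one>\<^bsub>X\<^esub>\<rparr>"
  define Y where "Y = with_topology M (quotient_topology (topol X) f)"
  have cY: "carrier Y = f ` carrier X" and oY: "\<one>\<^bsub>Y\<^esub> = f \<one>\<^bsub>X\<^esub>"
    and tY: "topspace (topol Y) = f ` carrier X"
    by (simp_all add: Y_def M_def tX)
  have mY: "f x \<otimes>\<^bsub>Y\<^esub> f y = f (x \<otimes>\<^bsub>X\<^esub> y)" if "x \<in> carrier X" "y \<in> carrier X" for x y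
    using that by (simp add: Y_def M_def gf)
  have cgY: "comm_group Y"
  proof (rule comm_groupI)
    fix a assume "a \<in> carrier Y"
    then obtain x where x: "x \<in> carrier X" "a = f x" by (auto simp: cY)
    then have "f (inv\<^bsub>X\<^esub> x) \<in> carrier Y" "f (inv\<^bsub>X\<^esub> x) \<otimes>\<^bsub>Y\<^esub> a = \<one>\<^bsub>Y\<^esub>"
      by (auto simp: cY mY oY)
    then show "\<exists>y\<in>carrier Y. y \<otimes>\<^bsub>Y\<^esub> a = \<one>\<^bsub>Y\<^esub>" by blast
  qed (auto simp: cY mY oY X.m_ac)
  interpret Y: comm_group Y by (rule cgY)
  have fh: "f \<in> hom X Y" by (auto simp: hom_def cY mY)
  interpret f: group_hom X Y f
    by (intro group_hom.intro group_hom_axioms.intro X.is_group Y.is_group fh)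
  have gh: "g \<in> hom Y X"
  proof (rule homI)
    fix a b assume "a \<in> carrier Y" "b \<in> carrier Y"
    then obtain x y where "x \<in> carrier X" "y \<in> carrier X" "a = f x" "b = f y"
      unfolding cY by blast
    then show "g (a \<otimes>\<^bsub>Y\<^esub> b) = g a \<otimes>\<^bsub>X\<^esub> g b" by (simp only: mY gf X.m_closed)
  next
    fix a assume "a \<in> carrier Y"
    then obtain x where "x \<in> carrier X" "a = f x" unfolding cY by blast
    then show "g a \<in> carrier X" by (simp only: gf)
  qed
  interpret g: group_hom Y X g
    by (intro group_hom.intro group_hom_axioms.intro X.is_group Y.is_group gh)
  have qf: "quotient_map (topol X) (topol Y) f"
    by (simp add: Y_def quotient_map_quotient_topology)
  then have hf: "homeomorphic_map (topol X) (topol Y) f"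
    using injf by (simp add: homeomorphic_map_def tX)
  have cf: "continuous_map (topol X) (topol Y) f"
    using qf by (rule quotient_imp_continuous_map)
  have cg: "continuous_map (topol Y) (topol X) g"
    by (rule continuous_compose_quotient_map[OF qf])
      (rule continuous_map_eq[OF continuous_map_id], simp add: tX gf)
  have opf: "open_map (topol X) (topol Y) f"
    using hf homeomorphic_imp_open_map by blast
  have HY: "Hausdorff_space (topol Y)"
    using X hf homeomorphic_Hausdorff_space homeomorphic_map_imp_homeomorphic_space
    by (metis top_ab_group_def)
  have contm: "continuous_map (prod_topology (topol Y) (topol Y)) (topol Y) (\<lambda>(a, b). a \<otimes>\<^bsub>Y\<^esub> b)"
  proof -
    have 1: "continuous_map (prod_topology (topol Y) (topol Y)) (prod_topology (topol X) (topol X))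
        (\<lambda>(a, b). (g a, g b))"
      using cg by (simp add: continuous_map_prod_top)
    have 2: "continuous_map (prod_topology (topol X) (topol X)) (topol Y) (f \<circ> (\<lambda>(a, b). a \<otimes>\<^bsub>X\<^esub> b))"
      using X cf by (metis continuous_map_compose top_ab_group_def)
    show ?thesis
    proof (rule continuous_map_eq[OF continuous_map_compose[OF 1 2]])
      fix z assume "z \<in> topspace (prod_topology (topol Y) (topol Y))"
      then have "fst z \<in> f ` carrier X" "snd z \<in> f ` carrier X"
        unfolding topspace_prod_topology tY by auto
      then obtain x y where xy: "x \<in> carrier X" "y \<in> carrier X" "fst z = f x" "snd z = f y"
        by blast
      then have z: "z = (f x, f y)" by (metis prod.collapse)
      show "((f \<circ> (\<lambda>(a, b). a \<otimes>\<^bsub>X\<^esub> b)) \<circ> (\<lambda>(a, b). (g a, g b))) z = (\<lambda>(a, b). a \<otimes>\<^bsub>Y\<^esub> b) z"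
        unfolding z by (simp only: o_apply prod.case gf xy(1,2) mY)
    qed
  qed
  have conti: "continuous_map (topol Y) (topol Y) (\<lambda>a. inv\<^bsub>Y\<^esub> a)"
  proof -
    have 2: "continuous_map (topol X) (topol Y) (f \<circ> (\<lambda>x. inv\<^bsub>X\<^esub> x))"
      using X cf by (metis continuous_map_compose top_ab_group_def)
    show ?thesis
    proof (rule continuous_map_eq[OF continuous_map_compose[OF cg 2]])
      fix a assume "a \<in> topspace (topol Y)"
      then obtain x where x: "x \<in> carrier X" "a = f x" unfolding tY by blast
      then show "((f \<circ> (\<lambda>x. inv\<^bsub>X\<^esub> x)) \<circ> g) a = inv\<^bsub>Y\<^esub> a"
        by (simp only: o_apply gf f.hom_inv)
    qed
  qed
  have pgY: "(p \<circ> g) ` carrier Y = p ` carrier X"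
    unfolding cY image_comp by (intro image_cong) (simp_all add: gf)
  have Y: "top_ab_group Y"
    unfolding top_ab_group_def using cgY HY contm conti by (simp add: tY cY)
  define E' where "E' = \<lparr>mid = Y, inc = f \<circ> i, prj = p \<circ> g\<rparr>"
  have iX: "i h \<in> carrier X" if "h \<in> carrier H" for h
    using that ih by (auto simp: cont_hom_def hom_def)
  have "is_extension G H E'"
    unfolding is_extension_def
  proof (intro conjI)
    show "top_ab_group (mid E')" using Y by (simp add: E'_def)
    show "inc E' \<in> cont_hom H (mid E')"
      using ih fh cf
      by (auto simp: E'_def cont_hom_def intro: Group.hom_compose continuous_map_compose)
    show "prj E' \<in> cont_hom (mid E') G"
      using Group.hom_compose[OF gh p.homh] continuous_map_compose[OF cg, of "topol G" p] ph
      by (simp add: E'_def cont_hom_def)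
    show "inj_on (inc E') (carrier H)"
      using inj injf iX by (auto simp: E'_def intro!: comp_inj_on intro: inj_on_subset)
    show "inc E' ` carrier H = kernel (mid E') G (prj E')"
    proof -
      have "inc E' ` carrier H = f ` kernel X G p" by (simp add: E'_def ex[symmetric] image_image)
      also have "\<dots> = kernel (mid E') G (prj E')"
      proof (intro equalityI subsetI)
        fix a assume "a \<in> kernel (mid E') G (prj E')"
        then have "a \<in> f ` carrier X" "p (g a) = \<one>\<^bsub>G\<^esub>"
          by (simp_all add: E'_def kernel_def cY)
        then obtain x where "x \<in> carrier X" "a = f x" "p (g a) = \<one>\<^bsub>G\<^esub>" by blast
        then have "x \<in> kernel X G p" "a = f x" by (simp_all add: kernel_def gf)
        then show "a \<in> f ` kernel X G p" by blast
      next
        fix a assume "a \<in> f ` kernel X G p"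
        then obtain x where "x \<in> carrier X" "p x = \<one>\<^bsub>G\<^esub>" "a = f x"
          by (auto simp only: kernel_def)
        then show "a \<in> kernel (mid E') G (prj E')"
          by (simp add: E'_def kernel_def cY gf)
      qed
      finally show ?thesis .
    qed
    show "prj E' ` carrier (mid E') = carrier G"
      using sur pgY by (simp add: E'_def)
    show "open_onto_image H (mid E') (inc E')"
      unfolding open_onto_image_def open_map_def
    proof (intro allI impI)
      fix U assume U: "openin (topol H) U"
      then have "openin (subtopology (topol X) (i ` carrier H)) (i ` U)"
        using oi by (simp add: open_onto_image_def open_map_def)
      then obtain V where V: "openin (topol X) V" "i ` U = V \<inter> i ` carrier H"
        by (auto simp: openin_subtopology)
      have "V \<subseteq> carrier X" using V tX openin_subset by blast
      then have "f ` (V \<inter> i ` carrier H) = f ` V \<inter> f ` i ` carrier H"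
        using injf iX by (intro inj_on_image_Int[of f "carrier X"]) auto
      moreover have "openin (topol Y) (f ` V)" using opf V by (simp add: open_map_def)
      ultimately show "openin (subtopology (topol (mid E')) (inc E' ` carrier H)) (inc E' ` U)"
        unfolding openin_subtopology using V(2)
        by (intro exI[of _ "f ` V"]) (simp add: E'_def image_comp[symmetric] del: o_apply)
    qed
    show "open_onto_image (mid E') G (prj E')"
      unfolding open_onto_image_def open_map_def
    proof (intro allI impI)
      fix U assume U: "openin (topol (mid E')) U"
      then have UY: "openin (topol Y) U" by (simp add: E'_def)
      then have sub: "U \<subseteq> f ` carrier X" using tY openin_subset by blast
      have "g ` U = {x \<in> carrier X. f x \<in> U}"
      proof (intro equalityI subsetI)
        fix x assume "x \<in> g ` U"
        then obtain a where "a \<in> U" "x = g a" by blast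
        moreover from this sub obtain y where "y \<in> carrier X" "a = f y" by blast
        ultimately show "x \<in> {x \<in> carrier X. f x \<in> U}" by (simp add: gf)
      next
        fix x assume "x \<in> {x \<in> carrier X. f x \<in> U}"
        then have "x = g (f x)" "f x \<in> U" by (simp_all add: gf)
        then show "x \<in> g ` U" by (rule image_eqI)
      qed
      moreover have "openin (topol X) {x \<in> carrier X. f x \<in> U}"
        using openin_continuous_map_preimage[OF cf UY] by (simp add: tX)
      ultimately have "openin (topol X) (g ` U)" by simp
      then have "openin (subtopology (topol G) (p ` carrier X)) (p ` g ` U)"
        using op by (simp add: open_onto_image_def open_map_def)
      moreover have "prj E' ` carrier (mid E') = p ` carrier X"
        using pgY by (simp add: E'_def)
      ultimately show "openin (subtopology (topol G) (prj E' ` carrier (mid E'))) (prj E' ` U)"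
        by (simp add: E'_def image_comp[symmetric] del: o_apply)
    qed
  qed
  moreover have "ext_equiv H E E'"
    unfolding ext_equiv_def
  proof (intro bexI[of _ f] conjI ballI)
    show "f \<in> cont_hom (mid E) (mid E')"
      using fh cf by (simp add: E'_def cont_hom_def X_def)
    show "f (inc E h) = inc E' h" for h by (simp add: E'_def i_def)
    show "prj E' (f x) = prj E x" if "x \<in> carrier (mid E)" for x
      using that by (simp add: E'_def gf p_def X_def)
  qed
  moreover have "ext_equiv H E' E"
    unfolding ext_equiv_def
  proof (intro bexI[of _ g] conjI ballI)
    show "g \<in> cont_hom (mid E') (mid E)"
      using gh cg by (simp add: E'_def cont_hom_def X_def)
    show "g (inc E' h) = inc E h" if "h \<in> carrier H" for h
      using iX[OF that] by (simp add: E'_def gf i_def)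
    show "prj E (g a) = prj E' a" for a by (simp add: E'_def p_def)
  qed
  ultimately show ?thesis by blast
qed

end

theory Submission
  imports Defs
begin

text \<open>The isomorphism is restriction: the class of an extension \<open>E\<close> of \<open>G\<close> goes to the class of its
  pull-back along the inclusion of \<open>A\<close>. Pull-backs and Baer sums are functorial, so this is a well-defined
  homomorphism for every subgroup. Divisibility of \<open>H\<close> and openness of \<open>A\<close> make it bijective.

  A divisible group is injective among abstract abelian groups: homomorphisms into it extend from subgroups
  (\<open>divisible_hom_extends\<close>). So every extension by \<open>H\<close> splits if topologies are forgotten, and
  its middle group may be thought of as \<open>H \<times> G\<close> with an exotic group topology. Such a topology is
  determined by what it induces on the open subgroup \<open>H \<times> A\<close>, and conversely a group topology on
  \<open>H \<times> A\<close> extends to one on \<open>H \<times> G\<close> for which \<open>H \<times> A\<close> is open. The second remark gives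
  surjectivity (\<open>extension_from_open_subgroup\<close>). For injectivity, an equivalence between restrictions
  extends to a homomorphism over \<open>G\<close> because \<open>H\<close> is injective, and this is continuous because it is so
  on an open subgroup (\<open>ext_equiv_if_restrict\<close>).

  The rest is the general theory of extensions of topological abelian groups. Pull-backs, products and
  push-outs of extensions are extensions, which rests on the quotient of a topological group by a closed
  kernel being a Hausdorff group (\<open>top_ab_group_quotient\<close>); they are functorial; and a morphism over
  the identity of \<open>G\<close> has a continuous inverse (\<open>ext_equiv_sym\<close>). These turn
  statements about Baer sums and classes into the existence of single morphisms.\<close>

section \<open>Divisible groups are injective\<close>

lemma DirProd_subgroup_int_pow:
  assumes X: "group X" and H: "group H" and R: "subgroup R (X \<times>\<times> H)" and xy: "(x, y) \<in> R"
  shows "(x [^]\<^bsub>X\<^esub> (k::int), y [^]\<^bsub>H\<^esub> k) \<in> R"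
proof -
  interpret X: group X by (rule X)
  interpret H: group H by (rule H)
  have c: "x \<in> carrier X" "y \<in> carrier H" using subgroup.mem_carrier[OF R xy] by auto
  have nat: "(x [^]\<^bsub>X\<^esub> (n::nat), y [^]\<^bsub>H\<^esub> n) \<in> R" for n
  proof (induction n)
    case 0
    then show ?case using subgroup.one_closed[OF R] by simp
  next
    case (Suc n)
    then show ?case using subgroup.m_closed[OF R Suc xy] by simp
  qed
  show ?thesis
  proof (cases k rule: int_cases2)
    case (nonneg n)
    then show ?thesis using nat[of n] by (simp add: int_pow_int)
  next
    case (nonpos n)
    then show ?thesis
      using subgroup.m_inv_closed[OF R nat[of n]] c by (simp add: X.int_pow_neg_int H.int_pow_neg_int X H)
  qed
qed

text \<open>Zorn's lemma is applied to graphs: a partial homomorphism extending \<open>f\<close> is a subgroup of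
  \<open>X \<times> H\<close> that contains the graph of \<open>f\<close> and meets the vertical fibre over \<open>\<one>\<close> only in \<open>\<one>\<close>. These
  conditions pass to unions of chains for free. If a maximal one missed some \<open>g\<close> in its domain, a value
  \<open>h\<close> for \<open>g\<close> would only have to be compatible with the values already assigned to powers of \<open>g\<close>.
  The exponents concerned are the multiples of a single \<open>n\<close>, so when \<open>n > 0\<close> it suffices that
  \<open>h\<close> be an \<open>n\<close>-th root of the value at the \<open>n\<close>-th power of \<open>g\<close>; divisibility provides one.\<close>

lemma divisible_hom_extends:
  assumes X: "comm_group X" and H: "comm_group H" and div: "divisible_group H"
    and A: "subgroup A X" and f: "f \<in> hom (X\<lparr>carrier := A\<rparr>) H"
  shows "\<exists>f'\<in>hom X H. \<forall>x\<in>A. f' x = f x"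
proof -
  interpret X: comm_group X by (rule X)
  interpret H: comm_group H by (rule H)
  interpret P: group "X \<times>\<times> H" by (simp add: DirProd_group)
  interpret A: subgroup A X by (rule A)
  have fA: "f x \<in> carrier H" if "x \<in> A" for x using that f by (auto simp: hom_def)
  have fm: "f (x \<otimes>\<^bsub>X\<^esub> y) = f x \<otimes>\<^bsub>H\<^esub> f y" if "x \<in> A" "y \<in> A" for x y
    using that f by (auto simp: hom_def)
  have f1: "f \<one>\<^bsub>X\<^esub> = \<one>\<^bsub>H\<^esub>"
    using fm[of "\<one>\<^bsub>X\<^esub>" "\<one>\<^bsub>X\<^esub>"] fA[of "\<one>\<^bsub>X\<^esub>"] by simp
  define \<A> where "\<A> = {R. subgroup R (X \<times>\<times> H) \<and> (\<forall>h. (\<one>\<^bsub>X\<^esub>, h) \<in> R \<longrightarrow> h = \<one>\<^bsub>H\<^esub>) \<and>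
    (\<lambda>x. (x, f x)) ` A \<subseteq> R}"
  have graph: "(\<lambda>x. (x, f x)) ` A \<in> \<A>"
  proof -
    have "subgroup ((\<lambda>x. (x, f x)) ` A) (X \<times>\<times> H)"
    proof (rule P.subgroupI)
      show "(\<lambda>x. (x, f x)) ` A \<subseteq> carrier (X \<times>\<times> H)" using fA by auto
      show "(\<lambda>x. (x, f x)) ` A \<noteq> {}" using A.one_closed by blast
      show "a \<otimes>\<^bsub>X \<times>\<times> H\<^esub> b \<in> (\<lambda>x. (x, f x)) ` A"
        if ab: "a \<in> (\<lambda>x. (x, f x)) ` A" "b \<in> (\<lambda>x. (x, f x)) ` A" for a b
      proof -
        obtain x y where "x \<in> A" "y \<in> A" "a = (x, f x)" "b = (y, f y)" using ab by blast
        then show ?thesis by (simp add: image_iff flip: fm)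
      qed
      fix a assume "a \<in> (\<lambda>x. (x, f x)) ` A"
      then obtain x where x: "x \<in> A" "a = (x, f x)" by auto
      have "f (inv\<^bsub>X\<^esub> x) = inv\<^bsub>H\<^esub> f x"
        using x fm[of x "inv\<^bsub>X\<^esub> x"] fA f1 by (intro H.inv_equality[symmetric])
          (auto simp: H.m_comm)
      then show "inv\<^bsub>X \<times>\<times> H\<^esub> a \<in> (\<lambda>x. (x, f x)) ` A"
        using x fA by auto
    qed
    then show ?thesis by (auto simp: \<A>_def f1)
  qed
  have "\<exists>M\<in>\<A>. \<forall>R\<in>\<A>. M \<subseteq> R \<longrightarrow> R = M"
  proof (rule subset_Zorn_nonempty)
    show "\<A> \<noteq> {}" using graph by blast
    fix \<C> assume ne: "\<C> \<noteq> {}" and ch: "subset.chain \<A> \<C>"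
    then have C: "R \<in> \<A>" if "R \<in> \<C>" for R using that by (auto simp: subset_chain_def)
    have sub: "subgroup R (X \<times>\<times> H)" if "R \<in> \<C>" for R using C[OF that] by (simp add: \<A>_def)
    have "subgroup (\<Union>\<C>) (X \<times>\<times> H)"
    proof (rule P.subgroupI)
      show "\<Union>\<C> \<subseteq> carrier (X \<times>\<times> H)" using sub subgroup.subset by blast
      show "\<Union>\<C> \<noteq> {}" using ne sub subgroup.one_closed by blast
      show "inv\<^bsub>X \<times>\<times> H\<^esub> a \<in> \<Union>\<C>" if a: "a \<in> \<Union>\<C>" for a
      proof -
        obtain R where "R \<in> \<C>" "a \<in> R" using a by blast
        then show ?thesis using subgroup.m_inv_closed[OF sub, of R a] by blast
      qed
      fix a b assume "a \<in> \<Union>\<C>" "b \<in> \<Union>\<C>"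
      then obtain R S where "R \<in> \<C>" "S \<in> \<C>" "a \<in> R" "b \<in> S" by blast
      moreover from this have "R \<subseteq> S \<or> S \<subseteq> R" using ch by (auto simp: subset_chain_def)
      ultimately obtain Q where "Q \<in> \<C>" "a \<in> Q" "b \<in> Q" by blast
      then show "a \<otimes>\<^bsub>X \<times>\<times> H\<^esub> b \<in> \<Union>\<C>"
        using subgroup.m_closed[OF sub, of Q a b] by blast
    qed
    then show "\<Union>\<C> \<in> \<A>" using C ne unfolding \<A>_def by blast
  qed
  then obtain R where R: "R \<in> \<A>" and max: "\<And>S. S \<in> \<A> \<Longrightarrow> R \<subseteq> S \<Longrightarrow> S = R" by blast
  interpret R: subgroup R "X \<times>\<times> H" using R by (simp add: \<A>_def)
  have R1: "h = \<one>\<^bsub>H\<^esub>" if "(\<one>\<^bsub>X\<^esub>, h) \<in> R" for h using R that by (simp add: \<A>_def)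
  have Rg: "(x, f x) \<in> R" if "x \<in> A" for x using R that by (auto simp: \<A>_def)
  have Rc: "x \<in> carrier X" "y \<in> carrier H" if "(x, y) \<in> R" for x y
    using R.mem_carrier[OF that] by auto
  have Rm: "(x \<otimes>\<^bsub>X\<^esub> x', y \<otimes>\<^bsub>H\<^esub> y') \<in> R" if "(x, y) \<in> R" "(x', y') \<in> R" for x y x' y'
    using R.m_closed[OF that] by simp
  have Ri: "(inv\<^bsub>X\<^esub> x, inv\<^bsub>H\<^esub> y) \<in> R" if "(x, y) \<in> R" for x y
    using R.m_inv_closed[OF that] Rc[OF that] by simp
  have Rp: "(x [^]\<^bsub>X\<^esub> k, y [^]\<^bsub>H\<^esub> k) \<in> R" if "(x, y) \<in> R" for x y and k :: int
    by (rule DirProd_subgroup_int_pow[OF X.is_group H.is_group R.subgroup_axioms that])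
  have Rf: "y = y'" if "(x, y) \<in> R" "(x, y') \<in> R" for x y y'
  proof -
    have "y \<otimes>\<^bsub>H\<^esub> inv\<^bsub>H\<^esub> y' = \<one>\<^bsub>H\<^esub>" using Rm[OF that(1) Ri[OF that(2)]] R1 Rc[OF that(1)] by simp
    then show ?thesis
      using H.inv_equality[of y "inv\<^bsub>H\<^esub> y'"] Rc[OF that(1)] Rc[OF that(2)] by simp
  qed
  have total: "\<exists>h. (g, h) \<in> R" if g: "g \<in> carrier X" for g
  proof -
    have "\<exists>h\<in>carrier H. \<forall>k::int. \<forall>y. (g [^]\<^bsub>X\<^esub> k, y) \<in> R \<longrightarrow> y = h [^]\<^bsub>H\<^esub> k"
    proof (cases "\<exists>n::nat. n > 0 \<and> (\<exists>y. (g [^]\<^bsub>X\<^esub> int n, y) \<in> R)")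
      case True
      define n where "n = (LEAST n::nat. n > 0 \<and> (\<exists>y. (g [^]\<^bsub>X\<^esub> int n, y) \<in> R))"
      have n: "n > 0" "\<exists>y. (g [^]\<^bsub>X\<^esub> int n, y) \<in> R" using LeastI_ex[OF True] by (auto simp: n_def)
      have least: "n \<le> m" if "m > 0" "(g [^]\<^bsub>X\<^esub> int m, y) \<in> R" for m y
        unfolding n_def using that by (intro Least_le) blast
      obtain y0 where y0: "(g [^]\<^bsub>X\<^esub> int n, y0) \<in> R" using n by blast
      obtain h where h: "h \<in> carrier H" "h [^]\<^bsub>H\<^esub> n = y0"
        using div n(1) Rc(2)[OF y0] by (auto simp: divisible_group_def)
      have "y = h [^]\<^bsub>H\<^esub> k" if y: "(g [^]\<^bsub>X\<^esub> k, y) \<in> R" for k :: int and y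
      proof -
        define m where "m = k div int n"
        have km: "k = k mod int n + int n * m" by (simp add: m_def)
        have gm: "(g [^]\<^bsub>X\<^esub> (int n * m), y0 [^]\<^bsub>H\<^esub> m) \<in> R"
          using Rp[OF y0, of m] g by (simp add: X.int_pow_pow)
        have "k mod int n = k - int n * m" using km by linarith
        then have "g [^]\<^bsub>X\<^esub> (k mod int n) = g [^]\<^bsub>X\<^esub> k \<otimes>\<^bsub>X\<^esub> inv\<^bsub>X\<^esub> (g [^]\<^bsub>X\<^esub> (int n * m))"
          using g X.int_pow_diff[of g k "int n * m"] by simp
        then have "\<exists>z. (g [^]\<^bsub>X\<^esub> (k mod int n), z) \<in> R"
          using Rm[OF y Ri[OF gm]] by auto
        moreover have "0 \<le> k mod int n" "k mod int n < int n" using n(1) by simp_all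
        ultimately have "k mod int n = 0"
          using least[of "nat (k mod int n)"] by (cases "k mod int n = 0") force+
        then have k: "k = int n * m" using km by simp
        then have "y = y0 [^]\<^bsub>H\<^esub> m" using Rf y gm by simp
        also have "\<dots> = h [^]\<^bsub>H\<^esub> k" using h(1) k by (simp add: h(2)[symmetric] H.int_pow_pow int_pow_int[symmetric])
        finally show ?thesis .
      qed
      then show ?thesis using h(1) by blast
    next
      case False
      have "y = \<one>\<^bsub>H\<^esub> [^]\<^bsub>H\<^esub> k" if y: "(g [^]\<^bsub>X\<^esub> k, y) \<in> R" for k :: int and y
      proof -
        have neg: "(g [^]\<^bsub>X\<^esub> (- k), inv\<^bsub>H\<^esub> y) \<in> R" using Ri[OF y] g by (simp add: X.int_pow_neg)
        have no: "(g [^]\<^bsub>X\<^esub> int n, z) \<notin> R" if "n > 0" for n z using False that by blast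
        have "\<not> k > 0" using y no[of "nat k" y] by auto
        moreover have "\<not> - k > 0" using neg no[of "nat (- k)" "inv\<^bsub>H\<^esub> y"] by auto
        ultimately have "k = 0" by simp
        then show ?thesis using y R1 by simp
      qed
      then show ?thesis by blast
    qed
    \<comment> \<open>Adjoining \<open>(g, h)\<close> stays functional, which contradicts maximality.\<close>
    then obtain h where h: "h \<in> carrier H"
      and hk: "\<And>(k::int) y. (g [^]\<^bsub>X\<^esub> k, y) \<in> R \<Longrightarrow> y = h [^]\<^bsub>H\<^esub> k" by blast
    define S where "S = {(x \<otimes>\<^bsub>X\<^esub> g [^]\<^bsub>X\<^esub> k, y \<otimes>\<^bsub>H\<^esub> h [^]\<^bsub>H\<^esub> k) | x y (k::int). (x, y) \<in> R}"
    have SI: "(x \<otimes>\<^bsub>X\<^esub> g [^]\<^bsub>X\<^esub> k, y \<otimes>\<^bsub>H\<^esub> h [^]\<^bsub>H\<^esub> k) \<in> S" if "(x, y) \<in> R" for x y and k :: int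
      using that by (auto simp: S_def)
    have RS: "R \<subseteq> S"
    proof
      fix a assume "a \<in> R"
      then show "a \<in> S" using SI[of "fst a" "snd a" 0] Rc[of "fst a" "snd a"] by simp
    qed
    have "subgroup S (X \<times>\<times> H)"
    proof (rule P.subgroupI)
      show "S \<subseteq> carrier (X \<times>\<times> H)" using Rc g h by (auto simp: S_def)
      show "S \<noteq> {}" using RS R.one_closed by blast
    next
      fix a assume "a \<in> S"
      then obtain x y and k :: int where xy: "(x, y) \<in> R"
        and a: "a = (x \<otimes>\<^bsub>X\<^esub> g [^]\<^bsub>X\<^esub> k, y \<otimes>\<^bsub>H\<^esub> h [^]\<^bsub>H\<^esub> k)" by (auto simp: S_def)
      show "inv\<^bsub>X \<times>\<times> H\<^esub> a \<in> S"
        using SI[OF Ri[OF xy], of "- k"] Rc[OF xy] g h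
        by (simp add: a X.inv_mult H.inv_mult X.int_pow_neg H.int_pow_neg)
    next
      fix a b assume "a \<in> S" "b \<in> S"
      then obtain x y x' y' and k k' :: int where xy: "(x, y) \<in> R" "(x', y') \<in> R"
        and a: "a = (x \<otimes>\<^bsub>X\<^esub> g [^]\<^bsub>X\<^esub> k, y \<otimes>\<^bsub>H\<^esub> h [^]\<^bsub>H\<^esub> k)"
        and b: "b = (x' \<otimes>\<^bsub>X\<^esub> g [^]\<^bsub>X\<^esub> k', y' \<otimes>\<^bsub>H\<^esub> h [^]\<^bsub>H\<^esub> k')" by (auto simp: S_def)
      show "a \<otimes>\<^bsub>X \<times>\<times> H\<^esub> b \<in> S"
        using SI[OF Rm[OF xy], of "k + k'"] Rc[OF xy(1)] Rc[OF xy(2)] g h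
        by (simp add: a b X.int_pow_mult H.int_pow_mult X.m_ac H.m_ac)
    qed
    moreover have "z = \<one>\<^bsub>H\<^esub>" if "(\<one>\<^bsub>X\<^esub>, z) \<in> S" for z
    proof -
      obtain x y and k :: int where xy: "(x, y) \<in> R" and e: "x \<otimes>\<^bsub>X\<^esub> g [^]\<^bsub>X\<^esub> k = \<one>\<^bsub>X\<^esub>"
        and z: "z = y \<otimes>\<^bsub>H\<^esub> h [^]\<^bsub>H\<^esub> k" using \<open>(\<one>\<^bsub>X\<^esub>, z) \<in> S\<close> by (auto simp: S_def)
      have "g [^]\<^bsub>X\<^esub> (- k) = x"
        using e g Rc[OF xy] by (simp add: X.int_pow_neg X.inv_equality)
      then have "y = h [^]\<^bsub>H\<^esub> (- k)" using hk xy by blast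
      then show ?thesis using z h by (simp add: H.int_pow_neg)
    qed
    ultimately have "S \<in> \<A>" using RS Rg by (auto simp: \<A>_def)
    then have "S = R" using max RS by blast
    moreover have "(g, h) \<in> S"
      using SI[of "\<one>\<^bsub>X\<^esub>" "\<one>\<^bsub>H\<^esub>" 1] R.one_closed g h by simp
    ultimately show ?thesis by blast
  qed
  define f' where "f' x = (SOME y. (x, y) \<in> R)" for x
  have f': "(x, f' x) \<in> R" if "x \<in> carrier X" for x
    unfolding f'_def using total[OF that] by (rule someI_ex)
  show ?thesis
  proof (intro bexI[of _ f'] ballI)
    show "f' x = f x" if "x \<in> A" for x using Rf[OF f' Rg[OF that]] that by simp
    show "f' \<in> hom X H"
    proof (rule homI)
      show "f' x \<in> carrier H" if "x \<in> carrier X" for x using Rc(2)[OF f'[OF that]] .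
      show "f' (x \<otimes>\<^bsub>X\<^esub> y) = f' x \<otimes>\<^bsub>H\<^esub> f' y" if "x \<in> carrier X" "y \<in> carrier X" for x y
        using Rf[OF f' Rm[OF f' f']] that by simp
    qed
  qed
qed

section \<open>Topological abelian groups\<close>

lemma top_ab_groupD:
  assumes "top_ab_group G"
  shows "comm_group G" "group G" "topspace (topol G) = carrier G" "Hausdorff_space (topol G)"
  using assms by (auto simp: top_ab_group_def comm_group_def)

lemma continuous_map_group_mult:
  assumes G: "top_ab_group G" and f: "continuous_map T (topol G) f" and g: "continuous_map T (topol G) g"
  shows "continuous_map T (topol G) (\<lambda>x. f x \<otimes>\<^bsub>G\<^esub> g x)"
proof -
  have "continuous_map (prod_topology (topol G) (topol G)) (topol G) (\<lambda>(x, y). x \<otimes>\<^bsub>G\<^esub> y)"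
    using G by (simp add: top_ab_group_def)
  from continuous_map_compose[OF continuous_map_pairedI[OF f g] this]
  show ?thesis by (simp add: o_def)
qed

lemma continuous_map_group_inv:
  assumes G: "top_ab_group G" and f: "continuous_map T (topol G) f"
  shows "continuous_map T (topol G) (\<lambda>x. inv\<^bsub>G\<^esub> f x)"
proof -
  have "continuous_map (topol G) (topol G) (\<lambda>x. inv\<^bsub>G\<^esub> x)"
    using G by (simp add: top_ab_group_def)
  from continuous_map_compose[OF f this] show ?thesis by (simp add: o_def)
qed

lemma cont_homD:
  assumes "f \<in> cont_hom G K"
  shows "f \<in> hom G K" "continuous_map (topol G) (topol K) f"
    "\<And>x. x \<in> carrier G \<Longrightarrow> f x \<in> carrier K"
    "\<And>x y. x \<in> carrier G \<Longrightarrow> y \<in> carrier G \<Longrightarrow> f (x \<otimes>\<^bsub>G\<^esub> y) = f x \<otimes>\<^bsub>K\<^esub> f y"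
  using assms by (auto simp: cont_hom_def hom_def)

lemma cont_hom_group_hom:
  assumes "f \<in> cont_hom G K" "top_ab_group G" "top_ab_group K"
  shows "group_hom G K f"
  using assms by (auto simp: group_hom_def group_hom_axioms_def cont_hom_def dest: top_ab_groupD)

lemma cont_hom_id: "(\<lambda>x. x) \<in> cont_hom G G"
  by (simp add: cont_hom_def hom_def)

lemma cont_hom_compose:
  assumes "f \<in> cont_hom G K" "g \<in> cont_hom K L"
  shows "(\<lambda>x. g (f x)) \<in> cont_hom G L"
  using continuous_map_compose[OF cont_homD(2)[OF assms(1)] cont_homD(2)[OF assms(2)]]
    Group.hom_compose[OF cont_homD(1)[OF assms(1)] cont_homD(1)[OF assms(2)]]
  by (simp add: cont_hom_def o_def)

lemma inv_with_topology [simp]: "m_inv (with_topology M T) = m_inv M"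
  by (simp add: m_inv_def fun_eq_iff)

lemma hom_with_topology [simp]: "hom K (with_topology M T) = hom K M"
  by (simp add: hom_def)

lemma comm_group_with_topology:
  assumes "comm_group M"
  shows "comm_group (with_topology M T)"
proof -
  interpret comm_group M by (rule assms)
  show ?thesis by (rule comm_groupI) (auto simp: m_ac intro: l_inv_ex)
qed

lemma top_prod_simps [simp]:
  "carrier (top_prod G K) = carrier G \<times> carrier K"
  "(a, b) \<otimes>\<^bsub>top_prod G K\<^esub> (c, d) = (a \<otimes>\<^bsub>G\<^esub> c, b \<otimes>\<^bsub>K\<^esub> d)"
  "\<one>\<^bsub>top_prod G K\<^esub> = (\<one>\<^bsub>G\<^esub>, \<one>\<^bsub>K\<^esub>)"
  "topol (top_prod G K) = prod_topology (topol G) (topol K)"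
  by (simp_all add: top_prod_def)

lemma mult_top_prod:
  "x \<otimes>\<^bsub>top_prod G K\<^esub> y = (fst x \<otimes>\<^bsub>G\<^esub> fst y, snd x \<otimes>\<^bsub>K\<^esub> snd y)"
  by (cases x; cases y) simp

lemma inv_top_prod:
  assumes "top_ab_group G" "top_ab_group K" "x \<in> carrier G" "y \<in> carrier K"
  shows "inv\<^bsub>top_prod G K\<^esub> (x, y) = (inv\<^bsub>G\<^esub> x, inv\<^bsub>K\<^esub> y)"
  using assms by (simp add: top_prod_def top_ab_groupD)

lemma comm_group_DirProd:
  assumes "comm_group G" "comm_group K"
  shows "comm_group (G \<times>\<times> K)"
proof -
  interpret G: comm_group G by fact
  interpret K: comm_group K by fact
  interpret P: group "G \<times>\<times> K" by (simp add: DirProd_group)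
  show ?thesis by (rule P.group_comm_groupI) (auto simp: G.m_comm K.m_comm)
qed

lemma top_ab_group_top_prod:
  assumes G: "top_ab_group G" and K: "top_ab_group K"
  shows "top_ab_group (top_prod G K)"
proof -
  have cg: "comm_group (top_prod G K)"
    unfolding top_prod_def using G K
    by (intro comm_group_with_topology comm_group_DirProd) (simp_all add: top_ab_groupD)
  let ?T = "prod_topology (topol G) (topol K)"
  have m: "continuous_map (prod_topology ?T ?T) ?T (\<lambda>z. fst z \<otimes>\<^bsub>top_prod G K\<^esub> snd z)"
    unfolding mult_top_prod
    by (intro continuous_map_pairedI continuous_map_group_mult[OF G] continuous_map_group_mult[OF K]
        continuous_map_fst_of[OF continuous_map_fst, unfolded o_def]
        continuous_map_fst_of[OF continuous_map_snd, unfolded o_def]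
        continuous_map_snd_of[OF continuous_map_fst, unfolded o_def]
        continuous_map_snd_of[OF continuous_map_snd, unfolded o_def])
  have i: "continuous_map ?T ?T (\<lambda>z. inv\<^bsub>top_prod G K\<^esub> z)"
  proof (rule continuous_map_eq)
    show "continuous_map ?T ?T (\<lambda>z. (inv\<^bsub>G\<^esub> fst z, inv\<^bsub>K\<^esub> snd z))"
      by (intro continuous_map_pairedI continuous_map_group_inv[OF G] continuous_map_group_inv[OF K]
          continuous_map_fst continuous_map_snd)
  qed (use G K in \<open>auto simp: inv_top_prod top_ab_groupD\<close>)
  show ?thesis
    unfolding top_ab_group_def using cg m i G K
    by (simp add: top_ab_groupD case_prod_unfold Hausdorff_space_prod_topology)
qed

lemma top_subgroup_simps [simp]:
  "carrier (top_subgroup G A) = A"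
  "mult (top_subgroup G A) = mult G"
  "\<one>\<^bsub>top_subgroup G A\<^esub> = \<one>\<^bsub>G\<^esub>"
  "topol (top_subgroup G A) = subtopology (topol G) A"
  by (simp_all add: top_subgroup_def)

lemma inv_top_subgroup:
  assumes "top_ab_group G" "subgroup A G" "x \<in> A"
  shows "inv\<^bsub>top_subgroup G A\<^esub> x = inv\<^bsub>G\<^esub> x"
  using assms by (simp add: top_subgroup_def group.m_inv_consistent top_ab_groupD)

lemma top_ab_group_top_subgroup:
  assumes G: "top_ab_group G" and A: "subgroup A G"
  shows "top_ab_group (top_subgroup G A)"
proof -
  interpret G: comm_group G using G by (rule top_ab_groupD)
  interpret A: subgroup A G by (rule A)
  have cg: "comm_group (top_subgroup G A)"
  proof (rule comm_groupI)
    show "\<exists>y\<in>carrier (top_subgroup G A). y \<otimes>\<^bsub>top_subgroup G A\<^esub> x = \<one>\<^bsub>top_subgroup G A\<^esub>"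
      if "x \<in> carrier (top_subgroup G A)" for x
      using that A.subset by (intro bexI[of _ "inv\<^bsub>G\<^esub> x"]) auto
  qed (use A.subset in \<open>auto simp: G.m_ac subset_eq\<close>)
  let ?T = "subtopology (topol G) A"
  have t: "topspace ?T = A" using G A.subset by (auto simp: top_ab_groupD)
  have m: "continuous_map (prod_topology ?T ?T) ?T (\<lambda>z. fst z \<otimes>\<^bsub>G\<^esub> snd z)"
    by (intro continuous_map_into_subtopology continuous_map_group_mult[OF G]
        continuous_map_into_fulltopology[OF continuous_map_fst]
        continuous_map_into_fulltopology[OF continuous_map_snd]) (auto simp: t)
  have i: "continuous_map ?T ?T (\<lambda>z. inv\<^bsub>top_subgroup G A\<^esub> z)"
  proof (rule continuous_map_eq)
    show "continuous_map ?T ?T (\<lambda>z. inv\<^bsub>G\<^esub> z)"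
      by (intro continuous_map_into_subtopology continuous_map_group_inv[OF G]
          continuous_map_from_subtopology continuous_map_id[unfolded id_def]) (auto simp: t)
  qed (use G A in \<open>auto simp: inv_top_subgroup t\<close>)
  show ?thesis
    unfolding top_ab_group_def using cg m i t G
    by (simp add: top_ab_groupD case_prod_unfold Hausdorff_space_subtopology)
qed

lemma top_subgroup_cont_hom:
  assumes "A \<subseteq> carrier G"
  shows "(\<lambda>x. x) \<in> cont_hom (top_subgroup G A) G"
  using assms by (auto simp: cont_hom_def hom_def continuous_map_from_subtopology continuous_map_id[unfolded id_def])

lemma open_map_map_prod:
  assumes f: "open_map X X' f" and g: "open_map Y Y' g"
  shows "open_map (prod_topology X Y) (prod_topology X' Y') (map_prod f g)"
  unfolding open_map_def
proof (intro allI impI)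
  fix W assume W: "openin (prod_topology X Y) W"
  show "openin (prod_topology X' Y') (map_prod f g ` W)"
    unfolding openin_prod_topology_alt
  proof (intro allI impI)
    fix a b assume "(a, b) \<in> map_prod f g ` W"
    then obtain x y where xy: "(x, y) \<in> W" "a = f x" "b = g y" by auto
    then obtain U V where UV: "openin X U" "openin Y V" "x \<in> U" "y \<in> V" "U \<times> V \<subseteq> W"
      using W unfolding openin_prod_topology_alt by meson
    have "f ` U \<times> g ` V \<subseteq> map_prod f g ` W" using UV(5) by force
    then show "\<exists>U V. openin X' U \<and> openin Y' V \<and> a \<in> U \<and> b \<in> V \<and> U \<times> V \<subseteq> map_prod f g ` W"
      using UV f g xy by (intro exI[of _ "f ` U"] exI[of _ "g ` V"]) (auto simp: open_map_def)
  qed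
qed

text \<open>The saturation of an open set is the union of its translates by the kernel.\<close>

lemma open_map_quotient_topology:
  assumes P: "top_ab_group P" and M: "group M" and q: "q \<in> hom P M"
  shows "open_map (topol P) (quotient_topology (topol P) q) q"
  unfolding open_map_def
proof (intro allI impI)
  fix U assume U: "openin (topol P) U"
  interpret q: group_hom P M q
    using P M q by (simp add: group_hom_def group_hom_axioms_def top_ab_groupD)
  have UP: "U \<subseteq> carrier P" using openin_subset[OF U] P by (simp add: top_ab_groupD)
  have "{x \<in> carrier P. q x \<in> q ` U} =
      (\<Union>n\<in>kernel P M q. {x \<in> topspace (topol P). n \<otimes>\<^bsub>P\<^esub> x \<in> U})"
  proof (intro equalityI subsetI)
    fix x assume "x \<in> {x \<in> carrier P. q x \<in> q ` U}"
    then obtain u where x: "x \<in> carrier P" and u: "u \<in> U" "u \<in> carrier P" "q x = q u" using UP by auto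
    then have "u \<otimes>\<^bsub>P\<^esub> inv\<^bsub>P\<^esub> x \<in> kernel P M q" by (simp add: kernel_def)
    moreover have "u \<otimes>\<^bsub>P\<^esub> inv\<^bsub>P\<^esub> x \<otimes>\<^bsub>P\<^esub> x = u" using x u by (simp add: q.G.m_assoc)
    ultimately show "x \<in> (\<Union>n\<in>kernel P M q. {x \<in> topspace (topol P). n \<otimes>\<^bsub>P\<^esub> x \<in> U})"
      using x u P by (intro UN_I[of "u \<otimes>\<^bsub>P\<^esub> inv\<^bsub>P\<^esub> x"]) (simp_all add: top_ab_groupD)
  next
    fix x assume "x \<in> (\<Union>n\<in>kernel P M q. {x \<in> topspace (topol P). n \<otimes>\<^bsub>P\<^esub> x \<in> U})"
    then obtain n where n: "n \<in> carrier P" "q n = \<one>\<^bsub>M\<^esub>" and x: "x \<in> carrier P" "n \<otimes>\<^bsub>P\<^esub> x \<in> U"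
      using P by (auto simp: kernel_def top_ab_groupD)
    then have "q x = q (n \<otimes>\<^bsub>P\<^esub> x)" by simp
    then show "x \<in> {x \<in> carrier P. q x \<in> q ` U}" using x by blast
  qed
  moreover have "openin (topol P) {x \<in> topspace (topol P). n \<otimes>\<^bsub>P\<^esub> x \<in> U}"
    if "n \<in> kernel P M q" for n
    by (rule openin_continuous_map_preimage[OF continuous_map_group_mult[OF P] U])
      (use that P in \<open>auto simp: kernel_def top_ab_groupD continuous_map_id[unfolded id_def]\<close>)
  ultimately have "openin (topol P) {x \<in> carrier P. q x \<in> q ` U}" by auto
  then show "openin (quotient_topology (topol P) q) (q ` U)"
    using UP P by (auto simp: openin_quotient_topology top_ab_groupD)
qed

lemma closedin_fibre:
  assumes K: "top_ab_group K" and f: "continuous_map T (topol K) f" and c: "c \<in> carrier K"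
  shows "closedin T {z \<in> topspace T. f z = c}"
proof -
  have "closedin (topol K) {c}"
    using K c by (simp add: closedin_Hausdorff_sing_eq top_ab_groupD)
  from closedin_continuous_map_preimage[OF f this] show ?thesis by simp
qed

text \<open>The group \<open>M\<close> is any concrete copy of the quotient of \<open>P\<close> by the kernel, not necessarily the
  group of cosets. Since \<open>q\<close> is open, so is \<open>q \<times> q\<close>; both are therefore quotient maps, and continuity
  of the operations descends from \<open>P\<close>. For Hausdorffness, two points with different images differ by an
  element outside the closed kernel, hence so do all points of suitable neighbourhoods.\<close>

lemma top_ab_group_quotient:
  assumes P: "top_ab_group P" and M: "comm_group M" and q: "q \<in> hom P M"
    and sur: "q ` carrier P = carrier M" and cl: "closedin (topol P) (kernel P M q)"
  shows "top_ab_group (with_topology M (quotient_topology (topol P) q))"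
proof -
  interpret M: comm_group M by (rule M)
  interpret q: group_hom P M q
    using P q by (simp add: group_hom_def group_hom_axioms_def top_ab_groupD)
  let ?Q = "quotient_topology (topol P) q"
  have tP: "topspace (topol P) = carrier P" using P by (simp add: top_ab_groupD)
  have tQ: "topspace ?Q = carrier M" using sur tP by simp
  have om: "open_map (topol P) ?Q q" using P q M.is_group by (intro open_map_quotient_topology)
  have cq: "continuous_map (topol P) ?Q q"
    by (rule quotient_imp_continuous_map[OF quotient_map_quotient_topology])
  have "Hausdorff_space ?Q"
    unfolding Hausdorff_space_def
  proof (intro allI impI)
    fix a b assume ab: "a \<in> topspace ?Q \<and> b \<in> topspace ?Q \<and> a \<noteq> b"
    then obtain x y where xy: "x \<in> carrier P" "a = q x" "y \<in> carrier P" "b = q y"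
      using sur tQ by (metis imageE)
    let ?d = "\<lambda>z. fst z \<otimes>\<^bsub>P\<^esub> inv\<^bsub>P\<^esub> snd z"
    let ?W = "{z \<in> topspace (prod_topology (topol P) (topol P)). ?d z \<in> topspace (topol P) - kernel P M q}"
    have "openin (prod_topology (topol P) (topol P)) ?W"
      using cl by (intro openin_continuous_map_preimage[OF continuous_map_group_mult[OF P continuous_map_fst
            continuous_map_group_inv[OF P continuous_map_snd]]]) (simp add: closedin_def)
    moreover have dk: "?d (u, v) \<in> kernel P M q \<longleftrightarrow> q u = q v" if "u \<in> carrier P" "v \<in> carrier P" for u v
      using that M.inv_equality[of "q u" "inv\<^bsub>M\<^esub> q v"] by (auto simp: kernel_def)
    then have "(x, y) \<in> ?W" using xy ab tP by simp
    ultimately obtain U V where UV: "openin (topol P) U" "openin (topol P) V" "x \<in> U" "y \<in> V" "U \<times> V \<subseteq> ?W"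
      unfolding openin_prod_topology_alt by meson
    have "disjnt (q ` U) (q ` V)"
    proof -
      have "q u \<noteq> q v" if "u \<in> U" "v \<in> V" for u v
      proof -
        have "(u, v) \<in> ?W" using UV(5) that by blast
        then show ?thesis using dk[of u v] tP by auto
      qed
      then show ?thesis by (auto simp: disjnt_def)
    qed
    then show "\<exists>U V. openin ?Q U \<and> openin ?Q V \<and> a \<in> U \<and> b \<in> V \<and> disjnt U V"
      using UV om xy by (intro exI[of _ "q ` U"] exI[of _ "q ` V"]) (auto simp: open_map_def)
  qed
  moreover have "continuous_map (prod_topology ?Q ?Q) ?Q (\<lambda>(a, b). a \<otimes>\<^bsub>M\<^esub> b)"
  proof (rule continuous_compose_quotient_map)
    let ?qq = "\<lambda>(x, y). (q x, q y)"
    show "quotient_map (prod_topology (topol P) (topol P)) (prod_topology ?Q ?Q) ?qq"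
    proof (rule continuous_open_imp_quotient_map)
      show "continuous_map (prod_topology (topol P) (topol P)) (prod_topology ?Q ?Q) ?qq"
        using cq by (simp add: continuous_map_prod_top)
      show "?qq ` topspace (prod_topology (topol P) (topol P)) = topspace (prod_topology ?Q ?Q)"
        by (auto simp: image_iff)
      show "open_map (prod_topology (topol P) (topol P)) (prod_topology ?Q ?Q) ?qq"
        using open_map_map_prod[OF om om] by (simp add: map_prod_def)
    qed
    show "continuous_map (prod_topology (topol P) (topol P)) ?Q ((\<lambda>(a, b). a \<otimes>\<^bsub>M\<^esub> b) \<circ> ?qq)"
    proof (rule continuous_map_eq)
      show "continuous_map (prod_topology (topol P) (topol P)) ?Q (q \<circ> (\<lambda>z. fst z \<otimes>\<^bsub>P\<^esub> snd z))"
        by (rule continuous_map_compose[OF continuous_map_group_mult[OF P continuous_map_fst continuous_map_snd] cq])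
    qed (auto simp: tP)
  qed
  moreover have "continuous_map ?Q ?Q (\<lambda>a. inv\<^bsub>M\<^esub> a)"
  proof (rule continuous_compose_quotient_map[OF quotient_map_quotient_topology])
    show "continuous_map (topol P) ?Q ((\<lambda>a. inv\<^bsub>M\<^esub> a) \<circ> q)"
    proof (rule continuous_map_eq)
      show "continuous_map (topol P) ?Q (q \<circ> (\<lambda>z. inv\<^bsub>P\<^esub> z))"
        by (rule continuous_map_compose[OF continuous_map_group_inv[OF P continuous_map_id[unfolded id_def]] cq])
    qed (auto simp: tP)
  qed
  ultimately show ?thesis
    unfolding top_ab_group_def using tQ M by (simp add: comm_group_with_topology)
qed

section \<open>Extensions\<close>

locale top_extension =
  fixes G :: "'g top_group" and H :: "'h top_group" and E :: "('h, 'x, 'g) extension"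
  assumes top_G: "top_ab_group G" and top_H: "top_ab_group H" and ext: "is_extension G H E"
begin

abbreviation X where "X \<equiv> mid E"
abbreviation i where "i \<equiv> inc E"
abbreviation p where "p \<equiv> prj E"

lemma top_X: "top_ab_group X" and i_hom: "i \<in> cont_hom H X" and p_hom: "p \<in> cont_hom X G"
  and inj_i: "inj_on i (carrier H)" and i_image: "i ` carrier H = kernel X G p"
  and p_image: "p ` carrier X = carrier G"
  and i_open: "open_onto_image H X i" and p_open: "open_onto_image X G p"
  using ext by (auto simp: is_extension_def)

sublocale G: comm_group G using top_G by (rule top_ab_groupD)
sublocale H: comm_group H using top_H by (rule top_ab_groupD)
sublocale X: comm_group X using top_X by (rule top_ab_groupD)
sublocale i: group_hom H X i by (rule cont_hom_group_hom[OF i_hom top_H top_X])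
sublocale p: group_hom X G p by (rule cont_hom_group_hom[OF p_hom top_X top_G])

lemma topspace_eq [simp]: "topspace (topol G) = carrier G" "topspace (topol H) = carrier H"
  "topspace (topol X) = carrier X"
  using top_G top_H top_X by (simp_all add: top_ab_groupD)

lemma prj_inc [simp]: "h \<in> carrier H \<Longrightarrow> p (i h) = \<one>\<^bsub>G\<^esub>"
  using i_image by (auto simp: kernel_def)

lemma prj_surj:
  assumes "g \<in> carrier G"
  obtains x where "x \<in> carrier X" "p x = g"
  using p_image assms by (metis imageE)

lemma open_map_prj: "open_map (topol X) (topol G) p"
  using p_open subtopology_topspace[of "topol G"] by (simp add: open_onto_image_def p_image)

text \<open>As the inclusion is open onto its image, its inverse is a continuous homomorphism on the kernel of
  the projection.\<close>

definition coord :: "'x \<Rightarrow> 'h" where "coord = inv_into (carrier H) i"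

lemma coord_inc [simp]: "h \<in> carrier H \<Longrightarrow> coord (i h) = h"
  using inj_i by (simp add: coord_def)

lemma
  assumes "x \<in> carrier X" "p x = \<one>\<^bsub>G\<^esub>"
  shows coord_closed: "coord x \<in> carrier H" and inc_coord: "i (coord x) = x"
proof -
  have "x \<in> i ` carrier H" using assms i_image by (simp add: kernel_def)
  then show "coord x \<in> carrier H" "i (coord x) = x"
    by (auto simp: coord_def inv_into_into f_inv_into_f)
qed

lemma coord_mult:
  assumes "x \<in> carrier X" "p x = \<one>\<^bsub>G\<^esub>" "y \<in> carrier X" "p y = \<one>\<^bsub>G\<^esub>"
  shows "coord (x \<otimes>\<^bsub>X\<^esub> y) = coord x \<otimes>\<^bsub>H\<^esub> coord y"
  using assms coord_inc[of "coord x \<otimes>\<^bsub>H\<^esub> coord y"] by (simp add: coord_closed inc_coord)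

lemma continuous_map_coord:
  "continuous_map (subtopology (topol X) (kernel X G p)) (topol H) coord"
  unfolding continuous_map_def
proof (intro conjI allI impI)
  show "coord \<in> topspace (subtopology (topol X) (kernel X G p)) \<rightarrow> topspace (topol H)"
    by (auto simp: kernel_def coord_closed)
  fix U assume U: "openin (topol H) U"
  have UH: "U \<subseteq> carrier H" using openin_subset[OF U] by simp
  have "{x \<in> topspace (subtopology (topol X) (kernel X G p)). coord x \<in> U} = i ` U"
  proof (intro equalityI subsetI)
    fix x assume "x \<in> {x \<in> topspace (subtopology (topol X) (kernel X G p)). coord x \<in> U}"
    then show "x \<in> i ` U" by (intro image_eqI[of _ _ "coord x"]) (auto simp: kernel_def inc_coord)
  qed (use UH in \<open>auto simp: kernel_def\<close>)
  then show "openin (subtopology (topol X) (kernel X G p))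
      {x \<in> topspace (subtopology (topol X) (kernel X G p)). coord x \<in> U}"
    using i_open U by (simp add: open_onto_image_def open_map_def i_image)
qed

lemma continuous_map_coord_compose:
  assumes f: "continuous_map T (topol X) f" and k: "\<And>z. z \<in> topspace T \<Longrightarrow> p (f z) = \<one>\<^bsub>G\<^esub>"
  shows "continuous_map T (topol H) (\<lambda>z. coord (f z))"
proof -
  have "f z \<in> carrier X" if "z \<in> topspace T" for z
    using continuous_map_image_subset_topspace[OF f] that by auto
  then have "continuous_map T (subtopology (topol X) (kernel X G p)) f"
    using k by (intro continuous_map_into_subtopology[OF f]) (auto simp: kernel_def)
  from continuous_map_compose[OF this continuous_map_coord] show ?thesis by (simp add: o_def)
qed

end

text \<open>An inclusion whose inverse is continuous on the kernel of the projection is open onto its image.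
  An explicit formula \<open>j\<close> for the inverse is at hand for each of the extensions constructed below.\<close>

lemma is_extensionI:
  assumes G: "top_ab_group G" and H: "top_ab_group H" and X: "top_ab_group (mid E)"
    and i: "inc E \<in> cont_hom H (mid E)" and p: "prj E \<in> cont_hom (mid E) G"
    and pi: "\<And>h. h \<in> carrier H \<Longrightarrow> prj E (inc E h) = \<one>\<^bsub>G\<^esub>"
    and ji: "\<And>h. h \<in> carrier H \<Longrightarrow> j (inc E h) = h"
    and ij: "\<And>x. x \<in> carrier (mid E) \<Longrightarrow> prj E x = \<one>\<^bsub>G\<^esub> \<Longrightarrow> j x \<in> carrier H \<and> inc E (j x) = x"
    and cj: "continuous_map (subtopology (topol (mid E)) (kernel (mid E) G (prj E))) (topol H) j"
    and sur: "\<And>g. g \<in> carrier G \<Longrightarrow> \<exists>x\<in>carrier (mid E). prj E x = g"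
    and op: "open_map (topol (mid E)) (topol G) (prj E)"
  shows "is_extension G H E"
proof -
  have img: "inc E ` carrier H = kernel (mid E) G (prj E)"
  proof (intro equalityI subsetI)
    fix x assume "x \<in> kernel (mid E) G (prj E)"
    then show "x \<in> inc E ` carrier H"
      using ij[of x] by (intro image_eqI[of _ _ "j x"]) (auto simp: kernel_def)
  qed (use pi cont_homD(3)[OF i] in \<open>auto simp: kernel_def\<close>)
  have sur': "prj E ` carrier (mid E) = carrier G"
    using sur cont_homD(3)[OF p] by (auto simp: image_iff eq_commute)
  have "open_onto_image H (mid E) (inc E)"
    unfolding open_onto_image_def open_map_def img
  proof (intro allI impI)
    fix U assume U: "openin (topol H) U"
    let ?K = "subtopology (topol (mid E)) (kernel (mid E) G (prj E))"
    have tK: "topspace ?K = kernel (mid E) G (prj E)"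
      using X by (auto simp: kernel_def top_ab_groupD)
    have UH: "U \<subseteq> carrier H" using openin_subset[OF U] H by (simp add: top_ab_groupD)
    have "inc E ` U = {x \<in> topspace ?K. j x \<in> U}"
      unfolding tK
    proof (intro equalityI subsetI)
      fix x assume "x \<in> inc E ` U"
      then obtain h where "h \<in> U" "h \<in> carrier H" "x = inc E h" using UH by blast
      then show "x \<in> {x \<in> kernel (mid E) G (prj E). j x \<in> U}" using ji img by auto
    next
      fix x assume "x \<in> {x \<in> kernel (mid E) G (prj E). j x \<in> U}"
      then show "x \<in> inc E ` U"
        using ij[of x] by (intro image_eqI[of _ _ "j x"]) (auto simp: kernel_def)
    qed
    then show "openin ?K (inc E ` U)" using openin_continuous_map_preimage[OF cj U] by simp
  qed
  moreover have "open_onto_image (mid E) G (prj E)"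
    using op subtopology_topspace[of "topol G"] G by (simp add: open_onto_image_def sur' top_ab_groupD)
  moreover have "inj_on (inc E) (carrier H)" using ji by (rule inj_on_inverseI)
  ultimately show ?thesis using X i p img sur' by (simp add: is_extension_def)
qed

section \<open>Pull-backs of extensions\<close>

lemma ext_pullback_simps [simp]:
  "mid (ext_pullback G' t E) = top_subgroup (top_prod (mid E) G')
     {(x, g). x \<in> carrier (mid E) \<and> g \<in> carrier G' \<and> prj E x = t g}"
  "inc (ext_pullback G' t E) = (\<lambda>h. (inc E h, \<one>\<^bsub>G'\<^esub>))"
  "prj (ext_pullback G' t E) = snd"
  by (simp_all add: ext_pullback_def)

lemma (in top_extension) is_extension_pullback:
  assumes G': "top_ab_group G'" and t: "t \<in> cont_hom G' G"
  shows "is_extension G' H (ext_pullback G' t E)"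
proof -
  interpret t: group_hom G' G t by (rule cont_hom_group_hom[OF t G' top_G])
  let ?P = "top_prod X G'"
  let ?A = "{(x, g). x \<in> carrier X \<and> g \<in> carrier G' \<and> p x = t g}"
  let ?T = "subtopology (prod_topology (topol X) (topol G')) ?A"
  have P: "top_ab_group ?P" using top_X G' by (rule top_ab_group_top_prod)
  interpret P: comm_group ?P using P by (rule top_ab_groupD)
  have tG': "topspace (topol G') = carrier G'" using G' by (rule top_ab_groupD)
  have A: "subgroup ?A ?P"
  proof (rule P.subgroupI)
    have "(\<one>\<^bsub>X\<^esub>, \<one>\<^bsub>G'\<^esub>) \<in> ?A" by simp
    then show "?A \<noteq> {}" by (metis empty_iff)
    show "inv\<^bsub>?P\<^esub> a \<in> ?A" if "a \<in> ?A" for a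
      using that by (auto simp: inv_top_prod[OF top_X G'])
    show "a \<otimes>\<^bsub>?P\<^esub> b \<in> ?A" if "a \<in> ?A" "b \<in> ?A" for a b
      using that by auto
  qed auto
  have tT: "topspace ?T = ?A" by (auto simp: tG')
  show ?thesis
  proof (rule is_extensionI[OF G' top_H, where j = "\<lambda>z. coord (fst z)"], unfold ext_pullback_simps top_subgroup_simps top_prod_simps)
    show "top_ab_group (top_subgroup ?P ?A)" by (rule top_ab_group_top_subgroup[OF P A])
    show "(\<lambda>h. (i h, \<one>\<^bsub>G'\<^esub>)) \<in> cont_hom H (top_subgroup ?P ?A)"
      using cont_homD(2)[OF i_hom]
      by (auto simp: cont_hom_def hom_def continuous_map_in_subtopology continuous_map_paired tG')
    show "snd \<in> cont_hom (top_subgroup ?P ?A) G'"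
      by (auto simp: cont_hom_def hom_def continuous_map_from_subtopology continuous_map_snd)
    show "snd (i h, \<one>\<^bsub>G'\<^esub>) = \<one>\<^bsub>G'\<^esub>" for h by simp
    show "coord (fst (i h, \<one>\<^bsub>G'\<^esub>)) = h" if "h \<in> carrier H" for h using that by simp
    show "coord (fst z) \<in> carrier H \<and> (i (coord (fst z)), \<one>\<^bsub>G'\<^esub>) = z"
      if "z \<in> ?A" "snd z = \<one>\<^bsub>G'\<^esub>" for z
      using that by (auto simp: coord_closed inc_coord)
    show "\<exists>z\<in>?A. snd z = g" if g: "g \<in> carrier G'" for g
    proof -
      obtain x where "x \<in> carrier X" "p x = t g" using prj_surj[of "t g"] g by auto
      then show ?thesis using g by (intro bexI[of _ "(x, g)"]) auto
    qed
    show "continuous_map (subtopology ?T (kernel (top_subgroup ?P ?A) G' snd)) (topol H) (\<lambda>z. coord (fst z))"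
      by (rule continuous_map_coord_compose)
        (auto simp: kernel_def tG' intro!: continuous_map_from_subtopology continuous_map_fst)
    show "open_map ?T (topol G') snd"
      unfolding open_map_def
    proof (intro allI impI)
      fix U assume "openin ?T U"
      then obtain V where V: "openin (prod_topology (topol X) (topol G')) V" "U = V \<inter> ?A"
        by (auto simp: openin_subtopology)
      show "openin (topol G') (snd ` U)"
      proof (subst openin_subopen, intro ballI)
        fix g assume "g \<in> snd ` U"
        then obtain x where xg: "(x, g) \<in> V" "x \<in> carrier X" "g \<in> carrier G'" "p x = t g"
          using V(2) by auto
        then obtain B C where BC: "openin (topol X) B" "openin (topol G') C" "x \<in> B" "g \<in> C" "B \<times> C \<subseteq> V"
          using V(1) unfolding openin_prod_topology_alt by meson
        \<comment> \<open>A point of \<open>C\<close> over which \<open>B\<close> has a point lifts to \<open>B \<times> C\<close>.\<close>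
        let ?D = "{g \<in> topspace (topol G'). t g \<in> p ` B} \<inter> C"
        have "openin (topol G') ?D"
          using BC open_map_prj cont_homD(2)[OF t]
          by (intro openin_Int openin_continuous_map_preimage[of _ "topol G"]) (auto simp: open_map_def)
        moreover have "?D \<subseteq> snd ` U"
        proof
          fix g' assume "g' \<in> ?D"
          then obtain b where b: "g' \<in> carrier G'" "g' \<in> C" "b \<in> B" "t g' = p b" by (auto simp: tG')
          moreover have "b \<in> carrier X" using openin_subset[OF BC(1)] b by auto
          ultimately have "(b, g') \<in> U" using BC(5) by (auto simp: V(2))
          then show "g' \<in> snd ` U" by force
        qed
        moreover have "g \<in> ?D" using BC xg by (auto simp: tG' intro: image_eqI[of _ _ x])
        ultimately show "\<exists>T. openin (topol G') T \<and> g \<in> T \<and> T \<subseteq> snd ` U" by blast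
      qed
    qed
  qed
qed

section \<open>Morphisms of extensions\<close>

text \<open>In \<^const>\<open>ext_equiv\<close> the base group does not occur: the projections only have to commute with
  the map of middle groups as functions. So if \<open>F\<close> is an extension of a subgroup \<open>A\<close> of \<open>G\<close> and \<open>E\<close>
  an extension of \<open>G\<close>, then \<open>ext_equiv H F E\<close> says that there is a morphism from \<open>F\<close> to \<open>E\<close> covering
  the inclusion of \<open>A\<close>. The functoriality results below are stated so as to cover this case too.\<close>

lemma ext_equiv_trans:
  assumes "ext_equiv H E E'" "ext_equiv H E' E''"
  shows "ext_equiv H E E''"
proof -
  obtain T where T: "T \<in> cont_hom (mid E) (mid E')"
    "\<And>h. h \<in> carrier H \<Longrightarrow> T (inc E h) = inc E' h"
    "\<And>x. x \<in> carrier (mid E) \<Longrightarrow> prj E' (T x) = prj E x"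
    using assms(1) unfolding ext_equiv_def by blast
  obtain T' where T': "T' \<in> cont_hom (mid E') (mid E'')"
    "\<And>h. h \<in> carrier H \<Longrightarrow> T' (inc E' h) = inc E'' h"
    "\<And>x. x \<in> carrier (mid E') \<Longrightarrow> prj E'' (T' x) = prj E' x"
    using assms(2) unfolding ext_equiv_def by blast
  show ?thesis
    unfolding ext_equiv_def
    by (rule bexI[OF _ cont_hom_compose[OF T(1) T'(1)]]) (simp add: T T' cont_homD(3)[OF T(1)])
qed

text \<open>A morphism \<open>T\<close> over \<open>G\<close> is bijective by the five lemma; the point is that its inverse is
  continuous. Choose for \<open>x'\<close> in the target a point \<open>x\<close> of the source over the same element of \<open>G\<close>.
  Then \<open>x'\<close> and \<open>T x\<close> differ by an element of \<open>H\<close>, and correcting \<open>x\<close> by it gives the preimage of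
  \<open>x'\<close>. This formula is continuous in the pair \<open>(x, x')\<close>, which ranges over the pull-back of one
  extension along the projection of the other; and the second coordinate of the pull-back is itself the
  projection of an extension, hence open and a quotient map. So the inverse is continuous in \<open>x'\<close> alone.\<close>

lemma ext_equiv_sym:
  assumes G: "top_ab_group G" and H: "top_ab_group H"
    and E: "is_extension G H E" and E': "is_extension G H E'" and eq: "ext_equiv H E E'"
  shows "ext_equiv H E' E"
proof -
  interpret E: top_extension G H E by (intro top_extension.intro G H E)
  interpret E': top_extension G H E' by (intro top_extension.intro G H E')
  obtain T where T: "T \<in> cont_hom E.X E'.X"
    and Ti: "\<And>h. h \<in> carrier H \<Longrightarrow> T (E.i h) = E'.i h"
    and pT: "\<And>x. x \<in> carrier E.X \<Longrightarrow> E'.p (T x) = E.p x"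
    using eq unfolding ext_equiv_def by blast
  interpret T: group_hom E.X E'.X T by (rule cont_hom_group_hom[OF T E.top_X E'.top_X])
  define S where "S x' x = x \<otimes>\<^bsub>E.X\<^esub> E.i (E'.coord (x' \<otimes>\<^bsub>E'.X\<^esub> inv\<^bsub>E'.X\<^esub> T x))" for x' x
  have ker: "E'.p (x' \<otimes>\<^bsub>E'.X\<^esub> inv\<^bsub>E'.X\<^esub> T x) = \<one>\<^bsub>G\<^esub>"
    if "x \<in> carrier E.X" "x' \<in> carrier E'.X" "E.p x = E'.p x'" for x x'
    using that by (simp add: pT)
  have S: "S x' x \<in> carrier E.X \<and> T (S x' x) = x'"
    if x: "x \<in> carrier E.X" "x' \<in> carrier E'.X" "E.p x = E'.p x'" for x x'
  proof -
    have c: "E'.coord (x' \<otimes>\<^bsub>E'.X\<^esub> inv\<^bsub>E'.X\<^esub> T x) \<in> carrier H"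
      using x by (intro E'.coord_closed ker) auto
    then have "T (S x' x) = T x \<otimes>\<^bsub>E'.X\<^esub> (x' \<otimes>\<^bsub>E'.X\<^esub> inv\<^bsub>E'.X\<^esub> T x)"
      using x by (simp add: S_def Ti E'.inc_coord[OF _ ker[OF x]])
    also have "\<dots> = x'" using x by (simp add: E'.X.m_lcomm)
    finally show ?thesis using c x by (simp add: S_def)
  qed
  have injT: "inj_on T (carrier E.X)"
  proof (rule T.inj_on_one_iff[THEN iffD2], intro allI impI)
    fix x assume x: "x \<in> carrier E.X" "T x = \<one>\<^bsub>E'.X\<^esub>"
    then have "E.p x = \<one>\<^bsub>G\<^esub>" using pT[of x] by simp
    then have c: "E.coord x \<in> carrier H" "E.i (E.coord x) = x" using x by (simp_all add: E.coord_closed E.inc_coord)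
    then have "E'.i (E.coord x) = E'.i \<one>\<^bsub>H\<^esub>" using Ti x by force
    then show "x = \<one>\<^bsub>E.X\<^esub>" using E'.inj_i c by (metis inj_onD E.H.one_closed E.i.hom_one)
  qed
  define T' where "T' = inv_into (carrier E.X) T"
  have T'T: "T' (T x) = x" if "x \<in> carrier E.X" for x using injT that by (simp add: T'_def)
  have lift: "\<exists>x\<in>carrier E.X. T x = x'" if x': "x' \<in> carrier E'.X" for x'
    using S x' by (metis E.prj_surj E'.p.hom_closed)
  have T': "T' x' \<in> carrier E.X" "T (T' x') = x'" if "x' \<in> carrier E'.X" for x'
    using lift[OF that] T'T by auto
  let ?P = "ext_pullback E'.X E'.p E"
  interpret P: top_extension E'.X H ?P
    by (intro top_extension.intro E'.top_X H E.is_extension_pullback E'.p_hom)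
  let ?A = "{(x, x'). x \<in> carrier E.X \<and> x' \<in> carrier E'.X \<and> E.p x = E'.p x'}"
  let ?T = "subtopology (prod_topology (topol E.X) (topol E'.X)) ?A"
  have q: "quotient_map ?T (topol E'.X) snd"
    using P.open_map_prj cont_homD(2)[OF P.p_hom] P.p_image P.topspace_eq(3)
    by (intro continuous_open_imp_quotient_map) simp_all
  have fc: "continuous_map ?T (topol E.X) fst" and sc: "continuous_map ?T (topol E'.X) snd"
    by (auto intro: continuous_map_from_subtopology continuous_map_fst continuous_map_snd)
  have "continuous_map ?T (topol E'.X) (\<lambda>z. snd z \<otimes>\<^bsub>E'.X\<^esub> inv\<^bsub>E'.X\<^esub> T (fst z))"
    by (intro continuous_map_group_mult continuous_map_group_inv E'.top_X sc
        continuous_map_compose[OF fc cont_homD(2)[OF T], unfolded o_def])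
  then have "continuous_map ?T (topol H) (\<lambda>z. E'.coord (snd z \<otimes>\<^bsub>E'.X\<^esub> inv\<^bsub>E'.X\<^esub> T (fst z)))"
    by (rule E'.continuous_map_coord_compose) (auto simp: pT)
  from continuous_map_compose[OF this cont_homD(2)[OF E.i_hom]]
  have cS: "continuous_map ?T (topol E.X) (\<lambda>z. S (snd z) (fst z))"
    unfolding S_def by (intro continuous_map_group_mult E.top_X fc) (simp add: o_def)
  have "continuous_map (topol E'.X) (topol E.X) T'"
  proof (rule continuous_compose_quotient_map[OF q], rule continuous_map_eq[OF cS])
    fix z assume "z \<in> topspace ?T"
    then have "S (snd z) (fst z) \<in> carrier E.X \<and> T (S (snd z) (fst z)) = snd z"
      by (intro S) auto
    then show "S (snd z) (fst z) = (T' \<circ> snd) z" using T'T by force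
  qed
  moreover have "T' \<in> hom E'.X E.X"
  proof (rule homI)
    fix x y assume xy: "x \<in> carrier E'.X" "y \<in> carrier E'.X"
    then have "T (T' x \<otimes>\<^bsub>E.X\<^esub> T' y) = x \<otimes>\<^bsub>E'.X\<^esub> y" using T' by simp
    then show "T' (x \<otimes>\<^bsub>E'.X\<^esub> y) = T' x \<otimes>\<^bsub>E.X\<^esub> T' y"
      using T'T[of "T' x \<otimes>\<^bsub>E.X\<^esub> T' y"] T' xy by simp
  qed (rule T')
  ultimately have "T' \<in> cont_hom E'.X E.X" by (simp add: cont_hom_def)
  moreover have "T' (E'.i h) = E.i h" if "h \<in> carrier H" for h
    using T'T[of "E.i h"] Ti that by simp
  moreover have "E.p (T' x) = E'.p x" if "x \<in> carrier E'.X" for x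
    using pT[of "T' x"] T' that by simp
  ultimately show ?thesis unfolding ext_equiv_def by blast
qed

section \<open>Products of extensions\<close>

lemma ext_prod_simps [simp]:
  "mid (ext_prod E1 E2) = top_prod (mid E1) (mid E2)"
  "inc (ext_prod E1 E2) = map_prod (inc E1) (inc E2)"
  "prj (ext_prod E1 E2) = map_prod (prj E1) (prj E2)"
  by (simp_all add: ext_prod_def)

lemma cont_hom_map_prod:
  assumes "f \<in> cont_hom G G'" "g \<in> cont_hom K K'"
  shows "map_prod f g \<in> cont_hom (top_prod G K) (top_prod G' K')"
  using assms continuous_map_prod_top[of "topol G" "topol K" "topol G'" "topol K'" f g]
  by (auto simp: cont_hom_def hom_def map_prod_def case_prod_unfold mult_top_prod)

lemma is_extension_prod:
  assumes G1: "top_ab_group G1" and H1: "top_ab_group H1" and E1: "is_extension G1 H1 E1"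
    and G2: "top_ab_group G2" and H2: "top_ab_group H2" and E2: "is_extension G2 H2 E2"
  shows "is_extension (top_prod G1 G2) (top_prod H1 H2) (ext_prod E1 E2)"
proof -
  interpret E1: top_extension G1 H1 E1 by (intro top_extension.intro G1 H1 E1)
  interpret E2: top_extension G2 H2 E2 by (intro top_extension.intro G2 H2 E2)
  let ?P = "top_prod E1.X E2.X"
  let ?p = "map_prod E1.p E2.p"
  show ?thesis
  proof (rule is_extensionI[where j = "\<lambda>z. (E1.coord (fst z), E2.coord (snd z))"], unfold ext_prod_simps)
    show "top_ab_group (top_prod G1 G2)" "top_ab_group (top_prod H1 H2)" "top_ab_group ?P"
      by (intro top_ab_group_top_prod G1 G2 H1 H2 E1.top_X E2.top_X)+
    show "map_prod E1.i E2.i \<in> cont_hom (top_prod H1 H2) ?P"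
      by (intro cont_hom_map_prod E1.i_hom E2.i_hom)
    show "?p \<in> cont_hom ?P (top_prod G1 G2)"
      by (intro cont_hom_map_prod E1.p_hom E2.p_hom)
    show "open_map (topol ?P) (topol (top_prod G1 G2)) ?p"
      using open_map_map_prod[OF E1.open_map_prj E2.open_map_prj] by simp
    show "\<exists>x\<in>carrier ?P. ?p x = g" if g: "g \<in> carrier (top_prod G1 G2)" for g
    proof -
      have "fst g \<in> carrier G1" "snd g \<in> carrier G2" using g by auto
      then obtain x y where "x \<in> carrier E1.X" "E1.p x = fst g" "y \<in> carrier E2.X" "E2.p y = snd g"
        by (metis E1.prj_surj E2.prj_surj)
      then show ?thesis by (intro bexI[of _ "(x, y)"]) auto
    qed
    show "continuous_map (subtopology (topol ?P) (kernel ?P (top_prod G1 G2) ?p)) (topol (top_prod H1 H2))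
        (\<lambda>z. (E1.coord (fst z), E2.coord (snd z)))"
      unfolding top_prod_simps
      by (intro continuous_map_pairedI E1.continuous_map_coord_compose E2.continuous_map_coord_compose
          continuous_map_from_subtopology continuous_map_fst continuous_map_snd)
        (auto simp: kernel_def)
  qed (auto simp: E1.coord_closed E1.inc_coord E2.coord_closed E2.inc_coord)
qed

section \<open>Push-outs of extensions\<close>

locale extension_pushout = top_extension G H E
  for G :: "'g top_group" and H :: "'h top_group" and E :: "('h, 'x, 'g) extension" +
  fixes H' :: "'k top_group" and t :: "'h \<Rightarrow> 'k"
  assumes top_H': "top_ab_group H'" and t_hom: "t \<in> cont_hom H H'"
begin

sublocale H': comm_group H' using top_H' by (rule top_ab_groupD)
sublocale t: group_hom H H' t by (rule cont_hom_group_hom[OF t_hom top_H top_H'])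

abbreviation P where "P \<equiv> top_prod H' X"
abbreviation N where "N \<equiv> pushout_kernel H t E"
abbreviation q where "q z \<equiv> N #>\<^bsub>P\<^esub> z"

lemma top_P: "top_ab_group P"
  using top_H' top_X by (rule top_ab_group_top_prod)

sublocale P: comm_group P using top_P by (rule top_ab_groupD)

text \<open>On the closed subgroup \<open>H' \<times> ker p\<close> of \<open>H' \<times> X\<close> the map \<open>retr\<close> is a continuous retraction onto
  \<open>H'\<close>, and the subgroup \<open>N\<close> divided out in the push-out is its kernel. So \<open>N\<close> is closed, and
  \<open>retr\<close> descends to the continuous inverse of the inclusion of \<open>H'\<close> into the push-out.\<close>

definition L :: "('k \<times> 'x) set" where
  "L = {(k, x). k \<in> carrier H' \<and> x \<in> carrier X \<and> p x = \<one>\<^bsub>G\<^esub>}"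

definition retr :: "'k \<times> 'x \<Rightarrow> 'k" where
  "retr = (\<lambda>z. fst z \<otimes>\<^bsub>H'\<^esub> t (coord (snd z)))"

lemma L_subset: "L \<subseteq> carrier P" by (auto simp: L_def)

lemma L_mult: "z \<in> L \<Longrightarrow> w \<in> L \<Longrightarrow> z \<otimes>\<^bsub>P\<^esub> w \<in> L"
  by (auto simp: L_def)

lemma retr_closed: "z \<in> L \<Longrightarrow> retr z \<in> carrier H'"
  by (auto simp: L_def retr_def coord_closed)

lemma retr_mult: "z \<in> L \<Longrightarrow> w \<in> L \<Longrightarrow> retr (z \<otimes>\<^bsub>P\<^esub> w) = retr z \<otimes>\<^bsub>H'\<^esub> retr w"
  by (auto simp: L_def retr_def coord_mult coord_closed H'.m_ac)

lemma retr_pair: "k \<in> carrier H' \<Longrightarrow> retr (k, \<one>\<^bsub>X\<^esub>) = k"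
  using coord_inc[of "\<one>\<^bsub>H\<^esub>"] by (simp add: retr_def)

lemma pushout_kernel_eq: "N = {z \<in> L. retr z = \<one>\<^bsub>H'\<^esub>}"
proof (intro equalityI subsetI)
  fix z assume "z \<in> N"
  then obtain h where h: "h \<in> carrier H" "z = (t h, inv\<^bsub>X\<^esub> i h)" by (auto simp: pushout_kernel_def)
  have "coord (inv\<^bsub>X\<^esub> i h) = inv\<^bsub>H\<^esub> h" using h coord_inc[of "inv\<^bsub>H\<^esub> h"] by simp
  then show "z \<in> {z \<in> L. retr z = \<one>\<^bsub>H'\<^esub>}" using h by (simp add: L_def retr_def)
next
  fix z assume "z \<in> {z \<in> L. retr z = \<one>\<^bsub>H'\<^esub>}"
  then obtain k x where z: "z = (k, x)" "k \<in> carrier H'" "x \<in> carrier X" "p x = \<one>\<^bsub>G\<^esub>"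
    "k \<otimes>\<^bsub>H'\<^esub> t (coord x) = \<one>\<^bsub>H'\<^esub>" by (auto simp: L_def retr_def)
  then have c: "coord x \<in> carrier H" "i (coord x) = x" by (simp_all add: coord_closed inc_coord)
  have "k = t (inv\<^bsub>H\<^esub> coord x)" using z c by (simp add: H'.inv_equality)
  moreover have "x = inv\<^bsub>X\<^esub> i (inv\<^bsub>H\<^esub> coord x)" using z c by simp
  ultimately show "z \<in> N"
    unfolding pushout_kernel_def z(1) using c by (intro image_eqI[of _ _ "inv\<^bsub>H\<^esub> coord x"]) auto
qed

lemma N_subgroup: "subgroup N P"
proof (rule P.subgroupI)
  have "(\<one>\<^bsub>H'\<^esub>, \<one>\<^bsub>X\<^esub>) \<in> N" by (simp add: pushout_kernel_eq retr_pair) (simp add: L_def)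
  then show "N \<noteq> {}" by (metis empty_iff)
  show "N \<subseteq> carrier P" using L_subset by (auto simp: pushout_kernel_eq)
  show "a \<otimes>\<^bsub>P\<^esub> b \<in> N" if "a \<in> N" "b \<in> N" for a b
    using that by (simp add: pushout_kernel_eq L_mult retr_mult)
  show "inv\<^bsub>P\<^esub> a \<in> N" if a: "a \<in> N" for a
  proof -
    obtain h where h: "h \<in> carrier H" "a = (t h, inv\<^bsub>X\<^esub> i h)" using a by (auto simp: pushout_kernel_def)
    then have "inv\<^bsub>P\<^esub> a = (t (inv\<^bsub>H\<^esub> h), inv\<^bsub>X\<^esub> i (inv\<^bsub>H\<^esub> h))" by (simp add: inv_top_prod[OF top_H' top_X])
    then show ?thesis unfolding pushout_kernel_def using h by (intro image_eqI[of _ _ "inv\<^bsub>H\<^esub> h"]) auto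
  qed
qed

sublocale N: normal N P by (rule P.subgroup_imp_normal[OF N_subgroup])

lemma q_hom: "q \<in> hom P (P Mod N)" by (rule N.r_coset_hom_Mod)

sublocale M: comm_group "P Mod N" by (rule P.abelian_FactGroup[OF N_subgroup])
sublocale q: group_hom P "P Mod N" q
  by (intro group_hom.intro group_hom_axioms.intro q_hom P.is_group M.is_group)

lemma q_image: "q ` carrier P = carrier (P Mod N)"
  by (auto simp: FactGroup_def RCOSETS_def)

lemma q_eq_one: "z \<in> carrier P \<Longrightarrow> q z = \<one>\<^bsub>P Mod N\<^esub> \<longleftrightarrow> z \<in> N"
  using P.coset_join1[OF _ _ N_subgroup] P.coset_join2[OF _ N_subgroup] by auto

lemma kernel_q: "kernel P (P Mod N) q = N"
  unfolding kernel_def using q_eq_one N.subset by blast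

lemma q_representative:
  assumes z: "z \<in> carrier P"
  obtains n where "n \<in> N" "(SOME w. w \<in> q z) = n \<otimes>\<^bsub>P\<^esub> z"
proof -
  have "(SOME w. w \<in> q z) \<in> q z" by (rule someI[of _ z]) (rule P.rcos_self[OF z N_subgroup])
  then show thesis using that by (auto simp: r_coset_def)
qed

abbreviation Q where "Q \<equiv> quotient_topology (topol P) q"

lemma mid_pushout: "mid (ext_pushout H H' t E) = with_topology (P Mod N) Q"
  and inc_pushout: "inc (ext_pushout H H' t E) = (\<lambda>k. q (k, \<one>\<^bsub>X\<^esub>))"
  by (simp_all add: ext_pushout_def Let_def top_quotient_def)

lemma prj_pushout:
  assumes z: "z \<in> carrier P"
  shows "prj (ext_pushout H H' t E) (q z) = p (snd z)"
proof -
  obtain n where n: "n \<in> N" "(SOME w. w \<in> q z) = n \<otimes>\<^bsub>P\<^esub> z" using q_representative[OF z] .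
  then have "n \<in> L" by (simp add: pushout_kernel_eq)
  then have "p (snd (n \<otimes>\<^bsub>P\<^esub> z)) = p (snd z)" using z by (auto simp: L_def)
  then show ?thesis by (simp add: ext_pushout_def Let_def n)
qed

lemma topspace_P: "topspace (topol P) = carrier P"
  using top_P by (rule top_ab_groupD)

lemma topspace_L: "topspace (subtopology (topol P) L) = L"
  using L_subset topspace_P by (metis inf.absorb_iff2 topspace_subtopology)

lemma continuous_map_retr: "continuous_map (subtopology (topol P) L) (topol H') retr"
proof -
  let ?T = "subtopology (topol P) L"
  have f: "continuous_map ?T (topol H') fst" and s: "continuous_map ?T (topol X) snd"
    by (simp_all add: continuous_map_from_subtopology continuous_map_fst continuous_map_snd)
  have "p (snd z) = \<one>\<^bsub>G\<^esub>" if "z \<in> topspace ?T" for z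
    using that unfolding topspace_L by (auto simp: L_def)
  then have "continuous_map ?T (topol H) (\<lambda>z. coord (snd z))"
    by (rule continuous_map_coord_compose[OF s])
  from continuous_map_compose[OF this cont_homD(2)[OF t_hom]]
  have "continuous_map ?T (topol H') (\<lambda>z. t (coord (snd z)))" by (simp only: o_def)
  then show ?thesis unfolding retr_def by (rule continuous_map_group_mult[OF top_H' f])
qed

lemma N_closed: "closedin (topol P) N"
proof -
  have 1: "closedin (topol P) L"
  proof -
    have "closedin (topol P) {z \<in> topspace (topol P). p (snd z) = \<one>\<^bsub>G\<^esub>}"
      using continuous_map_compose[OF continuous_map_snd cont_homD(2)[OF p_hom]]
      by (intro closedin_fibre[OF top_G]) (simp_all add: o_def)
    moreover have "{z \<in> topspace (topol P). p (snd z) = \<one>\<^bsub>G\<^esub>} = L"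
      unfolding topspace_P by (auto simp: L_def)
    ultimately show ?thesis by simp
  qed
  from continuous_map_retr
  have "closedin (subtopology (topol P) L) {z \<in> topspace (subtopology (topol P) L). retr z = \<one>\<^bsub>H'\<^esub>}"
    by (intro closedin_fibre[OF top_H']) simp_all
  then show ?thesis using closedin_trans_full[OF _ 1] unfolding topspace_L pushout_kernel_eq by blast
qed

lemma continuous_map_q: "continuous_map (topol P) Q q"
  by (rule quotient_imp_continuous_map[OF quotient_map_quotient_topology])

lemma open_map_q: "open_map (topol P) Q q"
  by (rule open_map_quotient_topology[OF top_P M.is_group q_hom])

lemma is_extension_pushout: "is_extension G H' (ext_pushout H H' t E)"
proof -
  let ?E = "ext_pushout H H' t E"
  let ?M = "with_topology (P Mod N) Q"
  have elim: "\<exists>z\<in>carrier P. C = q z" if "C \<in> carrier ?M" for C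
    using that q_image by (metis imageE with_topology_simps(1))
  define j where "j C = retr (SOME z. z \<in> C)" for C
  have jq: "j (q z) = retr z" if z: "z \<in> L" for z
  proof -
    have "z \<in> carrier P" using z L_subset by blast
    then obtain n where "n \<in> N" "(SOME w. w \<in> q z) = n \<otimes>\<^bsub>P\<^esub> z" by (rule q_representative)
    then show ?thesis using z by (simp add: j_def retr_mult pushout_kernel_eq retr_closed)
  qed
  have pL: "z \<in> L" if "z \<in> carrier P" "prj ?E (q z) = \<one>\<^bsub>G\<^esub>" for z
    using that prj_pushout[OF that(1)] by (auto simp: L_def)
  have qLK: "kernel ?M G (prj ?E) = q ` L"
  proof (intro equalityI subsetI)
    fix C assume "C \<in> kernel ?M G (prj ?E)"
    then show "C \<in> q ` L" using elim[of C] pL by (auto simp: kernel_def)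
  next
    fix C assume "C \<in> q ` L"
    then obtain z where z: "z \<in> L" "C = q z" by blast
    then have "z \<in> carrier P" "p (snd z) = \<one>\<^bsub>G\<^esub>" by (auto simp: L_def)
    then show "C \<in> kernel ?M G (prj ?E)" using prj_pushout z by (auto simp: kernel_def)
  qed
  show ?thesis
  proof (rule is_extensionI[OF top_G top_H', where j = j], unfold mid_pushout inc_pushout)
    show "top_ab_group ?M"
      using N_closed by (intro top_ab_group_quotient top_P M.comm_group_axioms q_hom q_image) (simp add: kernel_q)
    show "(\<lambda>k. q (k, \<one>\<^bsub>X\<^esub>)) \<in> cont_hom H' ?M"
    proof -
      have "(\<lambda>k. (k, \<one>\<^bsub>X\<^esub>)) \<in> hom H' P" by (auto simp: hom_def)
      moreover have "continuous_map (topol H') (topol P) (\<lambda>k. (k, \<one>\<^bsub>X\<^esub>))"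
        by (simp add: continuous_map_paired)
      ultimately show ?thesis
        using Group.hom_compose[OF _ q_hom, of "\<lambda>k. (k, \<one>\<^bsub>X\<^esub>)" H']
          continuous_map_compose[OF _ continuous_map_q, of "topol H'" "\<lambda>k. (k, \<one>\<^bsub>X\<^esub>)"]
        by (simp add: cont_hom_def o_def)
    qed
    show "prj ?E \<in> cont_hom ?M G"
    proof -
      have "prj ?E \<in> hom ?M G"
      proof (rule homI)
        show "prj ?E C \<in> carrier G" if "C \<in> carrier ?M" for C
          using elim[OF that] prj_pushout by auto
        fix C D assume "C \<in> carrier ?M" "D \<in> carrier ?M"
        then obtain z w where z: "z \<in> carrier P" "C = q z" and w: "w \<in> carrier P" "D = q w"
          using elim by blast
        then have "C \<otimes>\<^bsub>?M\<^esub> D = q (z \<otimes>\<^bsub>P\<^esub> w)" by simp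
        moreover have "snd z \<in> carrier X" "snd w \<in> carrier X" using z w by auto
        ultimately show "prj ?E (C \<otimes>\<^bsub>?M\<^esub> D) = prj ?E C \<otimes>\<^bsub>G\<^esub> prj ?E D"
          using z w prj_pushout[OF P.m_closed[OF z(1) w(1)]] by (simp add: prj_pushout mult_top_prod)
      qed
      moreover have "continuous_map Q (topol G) (prj ?E)"
      proof (rule continuous_compose_quotient_map[OF quotient_map_quotient_topology], rule continuous_map_eq)
        show "continuous_map (topol P) (topol G) (p \<circ> snd)"
          using continuous_map_compose[OF continuous_map_snd cont_homD(2)[OF p_hom]] by (simp only: top_prod_simps)
      qed (simp only: topspace_P prj_pushout o_apply)
      ultimately show ?thesis by (simp add: cont_hom_def)
    qed
    show "prj ?E (q (k, \<one>\<^bsub>X\<^esub>)) = \<one>\<^bsub>G\<^esub>" if "k \<in> carrier H'" for k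
      using that prj_pushout[of "(k, \<one>\<^bsub>X\<^esub>)"] by simp
    show "j (q (k, \<one>\<^bsub>X\<^esub>)) = k" if "k \<in> carrier H'" for k
      using that jq[of "(k, \<one>\<^bsub>X\<^esub>)"] by (simp add: retr_pair) (simp add: L_def)
    show "j C \<in> carrier H' \<and> q (j C, \<one>\<^bsub>X\<^esub>) = C" if C: "C \<in> carrier ?M" "prj ?E C = \<one>\<^bsub>G\<^esub>" for C
    proof -
      obtain z where z: "z \<in> carrier P" "C = q z" using elim C by blast
      then have zL: "z \<in> L" using pL C by simp
      obtain k x where kx: "z = (k, x)" "k \<in> carrier H'" "x \<in> carrier X" "p x = \<one>\<^bsub>G\<^esub>"
        using zL by (auto simp: L_def)
      have c: "coord x \<in> carrier H" "i (coord x) = x" using kx by (simp_all add: coord_closed inc_coord)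
      then have n: "(t (coord x), inv\<^bsub>X\<^esub> x) \<in> N" by (force simp: pushout_kernel_def)
      have "(j C, \<one>\<^bsub>X\<^esub>) = (t (coord x), inv\<^bsub>X\<^esub> x) \<otimes>\<^bsub>P\<^esub> z"
        using jq[OF zL] z(2) kx c by (simp add: retr_def H'.m_comm)
      then have "(j C, \<one>\<^bsub>X\<^esub>) \<in> q z" using n by (auto simp: r_coset_def)
      then have "q (j C, \<one>\<^bsub>X\<^esub>) = q z" using P.repr_independence[OF _ z(1) N_subgroup] by simp
      then show ?thesis using z(2) jq[OF zL] retr_closed[OF zL] by simp
    qed
    show "\<exists>C\<in>carrier ?M. prj ?E C = g" if g: "g \<in> carrier G" for g
    proof -
      obtain x where x: "x \<in> carrier X" "p x = g" using prj_surj[OF g] .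
      then have "(\<one>\<^bsub>H'\<^esub>, x) \<in> carrier P" by simp
      then show ?thesis
        using x prj_pushout[of "(\<one>\<^bsub>H'\<^esub>, x)"] q.hom_closed[of "(\<one>\<^bsub>H'\<^esub>, x)"]
        by (intro bexI[of _ "q (\<one>\<^bsub>H'\<^esub>, x)"]) simp_all
    qed
    show "continuous_map (subtopology (topol ?M) (kernel ?M G (prj ?E))) (topol H') j"
      unfolding with_topology_simps qLK
    proof (rule continuous_compose_quotient_map)
      have sat: "{z \<in> topspace (topol P). q z \<in> q ` L} = L"
      proof (intro equalityI subsetI)
        fix z assume z: "z \<in> {z \<in> topspace (topol P). q z \<in> q ` L}"
        then have "z \<in> carrier P" "q z \<in> kernel ?M G (prj ?E)" using topspace_P qLK by auto
        then show "z \<in> L" using pL by (simp add: kernel_def)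
      qed (use L_subset topspace_P in auto)
      show "quotient_map (subtopology (topol P) L) (subtopology Q (q ` L)) q"
      proof (rule continuous_open_imp_quotient_map)
        show "open_map (subtopology (topol P) L) (subtopology Q (q ` L)) q"
          by (rule open_map_restriction[OF open_map_q sat])
        show "continuous_map (subtopology (topol P) L) (subtopology Q (q ` L)) q"
          by (intro continuous_map_into_subtopology continuous_map_from_subtopology continuous_map_q)
            (simp only: topspace_L, blast)
        show "q ` topspace (subtopology (topol P) L) = topspace (subtopology Q (q ` L))"
          unfolding topspace_L topspace_subtopology topspace_quotient_topology topspace_P
          using L_subset by blast
      qed
      show "continuous_map (subtopology (topol P) L) (topol H') (j \<circ> q)"
        by (rule continuous_map_eq[OF continuous_map_retr]) (simp only: topspace_L o_apply jq)
    qed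
    show "open_map (topol ?M) (topol G) (prj ?E)"
      unfolding open_map_def with_topology_simps
    proof (intro allI impI)
      fix U assume U: "openin Q U"
      let ?V = "{z \<in> topspace (topol P). q z \<in> U}"
      have "openin (topol G) ((p \<circ> snd) ` ?V)"
        using open_map_compose[OF open_map_snd open_map_prj, of "topol H'"]
          openin_continuous_map_preimage[OF continuous_map_q U] by (simp add: open_map_def)
      moreover have "(p \<circ> snd) ` ?V = prj ?E ` U"
      proof -
        have "U = q ` ?V" using openin_subset[OF U] by auto
        then have "prj ?E ` U = (\<lambda>z. prj ?E (q z)) ` ?V" by (metis image_image)
        also have "\<dots> = (p \<circ> snd) ` ?V" unfolding topspace_P by (intro image_cong) (simp_all add: prj_pushout)
        finally show ?thesis by simp
      qed
      ultimately show "openin (topol G) (prj ?E ` U)" by simp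
    qed
  qed
qed

end

section \<open>Functoriality and the Baer sum\<close>

lemma ext_equiv_prod:
  assumes "ext_equiv H1 E1 F1" "ext_equiv H2 E2 F2"
  shows "ext_equiv (top_prod H1 H2) (ext_prod E1 E2) (ext_prod F1 F2)"
proof -
  obtain S where S: "S \<in> cont_hom (mid E1) (mid F1)"
    "\<forall>h\<in>carrier H1. S (inc E1 h) = inc F1 h" "\<forall>x\<in>carrier (mid E1). prj F1 (S x) = prj E1 x"
    using assms(1) by (auto simp: ext_equiv_def)
  obtain T where T: "T \<in> cont_hom (mid E2) (mid F2)"
    "\<forall>h\<in>carrier H2. T (inc E2 h) = inc F2 h" "\<forall>x\<in>carrier (mid E2). prj F2 (T x) = prj E2 x"
    using assms(2) by (auto simp: ext_equiv_def)
  show ?thesis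
    unfolding ext_equiv_def ext_prod_simps
    by (rule bexI[OF _ cont_hom_map_prod[OF S(1) T(1)]]) (use S T in auto)
qed

lemma ext_equiv_pullback:
  assumes eq: "ext_equiv H E F"
    and A: "carrier A \<subseteq> carrier G" "(\<lambda>a. a) \<in> cont_hom A G" "\<one>\<^bsub>A\<^esub> = \<one>\<^bsub>G\<^esub>"
    and st: "\<And>a. a \<in> carrier A \<Longrightarrow> s a = t a"
  shows "ext_equiv H (ext_pullback A s E) (ext_pullback G t F)"
proof -
  obtain S where S: "S \<in> cont_hom (mid E) (mid F)"
    "\<And>h. h \<in> carrier H \<Longrightarrow> S (inc E h) = inc F h" "\<And>x. x \<in> carrier (mid E) \<Longrightarrow> prj F (S x) = prj E x"
    using eq unfolding ext_equiv_def by blast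
  have m: "map_prod S (\<lambda>a. a) \<in> cont_hom (top_prod (mid E) A) (top_prod (mid F) G)"
    by (rule cont_hom_map_prod[OF S(1) A(2)])
  let ?B = "{(x, g). x \<in> carrier (mid E) \<and> g \<in> carrier A \<and> prj E x = s g}"
  let ?C = "{(x, g). x \<in> carrier (mid F) \<and> g \<in> carrier G \<and> prj F x = t g}"
  have "map_prod S (\<lambda>a. a) \<in> cont_hom (top_subgroup (top_prod (mid E) A) ?B) (top_subgroup (top_prod (mid F) G) ?C)"
  proof -
    have B: "map_prod S (\<lambda>a. a) z \<in> ?C" if "z \<in> ?B" for z
      using that cont_homD(3)[OF S(1)] S(3) A(1) st by auto
    have "map_prod S (\<lambda>a. a) \<in> hom (top_subgroup (top_prod (mid E) A) ?B) (top_subgroup (top_prod (mid F) G) ?C)"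
    proof (rule homI)
      show "map_prod S (\<lambda>a. a) z \<in> carrier (top_subgroup (top_prod (mid F) G) ?C)"
        if "z \<in> carrier (top_subgroup (top_prod (mid E) A) ?B)" for z
        using B[of z] that by (simp only: top_subgroup_simps)
    qed (use cont_homD(4)[OF m] in auto)
    moreover have "continuous_map (subtopology (topol (top_prod (mid E) A)) ?B)
        (subtopology (topol (top_prod (mid F) G)) ?C) (map_prod S (\<lambda>a. a))"
    proof (rule continuous_map_into_subtopology[OF continuous_map_from_subtopology[OF cont_homD(2)[OF m]]])
      show "map_prod S (\<lambda>a. a) \<in> topspace (subtopology (topol (top_prod (mid E) A)) ?B) \<rightarrow> ?C"
      proof (rule Pi_I)
        fix z assume "z \<in> topspace (subtopology (topol (top_prod (mid E) A)) ?B)"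
        then have "z \<in> ?B" unfolding topspace_subtopology by (rule IntD2)
        then show "map_prod S (\<lambda>a. a) z \<in> ?C" by (rule B)
      qed
    qed
    ultimately show ?thesis unfolding cont_hom_def by (simp only: top_subgroup_simps mem_Collect_eq)
  qed
  then show ?thesis
    unfolding ext_equiv_def ext_pullback_simps
    by (rule bexI[rotated]) (use S A in auto)
qed

text \<open>The map induced on push-outs is defined on cosets through representatives, and it is independent
  of them because the identity times \<open>S\<close> carries the pairs that span one kernel to those that span the
  other. The base groups may differ.\<close>

lemma ext_equiv_pushout:
  assumes E: "extension_pushout G1 H E H' t" and F: "extension_pushout G2 H F H' t"
    and eq: "ext_equiv H E F"
  shows "ext_equiv H' (ext_pushout H H' t E) (ext_pushout H H' t F)"
proof -
  interpret E: extension_pushout G1 H E H' t by (rule E)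
  interpret F: extension_pushout G2 H F H' t by (rule F)
  obtain S where S: "S \<in> cont_hom E.X F.X"
    and Si: "\<And>h. h \<in> carrier H \<Longrightarrow> S (E.i h) = F.i h"
    and Sp: "\<And>x. x \<in> carrier E.X \<Longrightarrow> F.p (S x) = E.p x"
    using eq unfolding ext_equiv_def by blast
  interpret S: group_hom E.X F.X S by (rule cont_hom_group_hom[OF S E.top_X F.top_X])
  let ?f = "map_prod (\<lambda>k. k) S"
  have f: "?f \<in> cont_hom E.P F.P" by (rule cont_hom_map_prod[OF cont_hom_id S])
  have fc: "?f z \<in> carrier F.P" if "z \<in> carrier E.P" for z using cont_homD(3)[OF f that] .
  have fN: "?f n \<in> F.N" if n: "n \<in> E.N" for n
  proof -
    obtain h where "h \<in> carrier H" "n = (t h, inv\<^bsub>E.X\<^esub> E.i h)" using n by (auto simp: pushout_kernel_def)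
    then show ?thesis unfolding pushout_kernel_def by (intro image_eqI[of _ _ h]) (simp_all add: Si)
  qed
  define T where "T C = F.q (?f (SOME z. z \<in> C))" for C
  have Tq: "T (E.q z) = F.q (?f z)" if z: "z \<in> carrier E.P" for z
  proof -
    obtain n where n: "n \<in> E.N" "(SOME w. w \<in> E.q z) = n \<otimes>\<^bsub>E.P\<^esub> z" using E.q_representative[OF z] .
    have nP: "n \<in> carrier E.P" using n(1) E.N.subset by blast
    have "T (E.q z) = F.q (?f n \<otimes>\<^bsub>F.P\<^esub> ?f z)"
      unfolding T_def n(2) cont_homD(4)[OF f nP z] ..
    also have "\<dots> = F.q (?f n) \<otimes>\<^bsub>F.P Mod F.N\<^esub> F.q (?f z)" by (rule F.q.hom_mult[OF fc[OF nP] fc[OF z]])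
    also have "F.q (?f n) = \<one>\<^bsub>F.P Mod F.N\<^esub>" using F.q_eq_one[OF fc[OF nP]] fN[OF n(1)] by (rule iffD2)
    finally show ?thesis using F.q.hom_closed[OF fc[OF z]] by (simp only: F.M.l_one)
  qed
  have elim: "\<exists>z\<in>carrier E.P. C = E.q z" if "C \<in> carrier (E.P Mod E.N)" for C
    using that E.q_image by (metis imageE)
  have "T \<in> hom (E.P Mod E.N) (F.P Mod F.N)"
  proof (rule homI)
    show "T C \<in> carrier (F.P Mod F.N)" if C: "C \<in> carrier (E.P Mod E.N)" for C
    proof -
      obtain z where z: "z \<in> carrier E.P" "C = E.q z" using elim[OF C] by blast
      show ?thesis unfolding z(2) Tq[OF z(1)] by (rule F.q.hom_closed[OF fc[OF z(1)]])
    qed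
    fix C D assume "C \<in> carrier (E.P Mod E.N)" "D \<in> carrier (E.P Mod E.N)"
    then obtain z w where z: "z \<in> carrier E.P" "C = E.q z" and w: "w \<in> carrier E.P" "D = E.q w"
      using elim by metis
    have "T (C \<otimes>\<^bsub>E.P Mod E.N\<^esub> D) = T (E.q (z \<otimes>\<^bsub>E.P\<^esub> w))"
      unfolding z(2) w(2) E.q.hom_mult[OF z(1) w(1)] ..
    also have "\<dots> = F.q (?f z \<otimes>\<^bsub>F.P\<^esub> ?f w)"
      unfolding Tq[OF E.P.m_closed[OF z(1) w(1)]] cont_homD(4)[OF f z(1) w(1)] ..
    also have "\<dots> = T C \<otimes>\<^bsub>F.P Mod F.N\<^esub> T D"
      unfolding z(2) w(2) Tq[OF z(1)] Tq[OF w(1)] by (rule F.q.hom_mult[OF fc[OF z(1)] fc[OF w(1)]])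
    finally show "T (C \<otimes>\<^bsub>E.P Mod E.N\<^esub> D) = T C \<otimes>\<^bsub>F.P Mod F.N\<^esub> T D" .
  qed
  moreover have "continuous_map E.Q F.Q T"
  proof (rule continuous_compose_quotient_map[OF quotient_map_quotient_topology], rule continuous_map_eq)
    show "continuous_map (topol E.P) F.Q (F.q \<circ> ?f)"
      by (rule continuous_map_compose[OF cont_homD(2)[OF f] F.continuous_map_q])
  qed (simp only: E.topspace_P o_apply Tq)
  ultimately have T: "T \<in> cont_hom (mid (ext_pushout H H' t E)) (mid (ext_pushout H H' t F))"
    by (simp add: cont_hom_def E.mid_pushout F.mid_pushout) (simp add: hom_def)
  show ?thesis
    unfolding ext_equiv_def
  proof (intro bexI[OF _ T] conjI ballI)
    fix k assume "k \<in> carrier H'"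
    then show "T (inc (ext_pushout H H' t E) k) = inc (ext_pushout H H' t F) k"
      unfolding E.inc_pushout F.inc_pushout by (subst Tq) simp_all
  next
    fix C assume "C \<in> carrier (mid (ext_pushout H H' t E))"
    then have "C \<in> carrier (E.P Mod E.N)" by (simp only: E.mid_pushout with_topology_simps)
    from elim[OF this] obtain z where z: "z \<in> carrier E.P" "C = E.q z" by blast
    then have "snd z \<in> carrier E.X" by auto
    then show "prj (ext_pushout H H' t F) (T C) = prj (ext_pushout H H' t E) C"
      unfolding z(2) Tq[OF z(1)] F.prj_pushout[OF fc[OF z(1)]] E.prj_pushout[OF z(1)]
      by (simp add: Sp)
  qed
qed

lemma cont_hom_mult:
  assumes H: "top_ab_group H"
  shows "(\<lambda>(h, k). h \<otimes>\<^bsub>H\<^esub> k) \<in> cont_hom (top_prod H H) H"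
proof -
  interpret comm_group H using H by (rule top_ab_groupD)
  show ?thesis using H by (auto simp: cont_hom_def hom_def top_ab_group_def m_ac)
qed

lemma cont_hom_diagonal: "(\<lambda>g. (g, g)) \<in> cont_hom G (top_prod G G)"
  by (auto simp: cont_hom_def hom_def continuous_map_paired continuous_map_id[unfolded id_def])

lemma extension_pushout_baer:
  assumes G: "top_ab_group G" and H: "top_ab_group H"
    and E1: "is_extension G H E1" and E2: "is_extension G H E2"
  shows "extension_pushout G (top_prod H H) (ext_pullback G (\<lambda>g. (g, g)) (ext_prod E1 E2)) H (\<lambda>(h, k). h \<otimes>\<^bsub>H\<^esub> k)"
proof -
  interpret P: top_extension "top_prod G G" "top_prod H H" "ext_prod E1 E2"
    by (intro top_extension.intro top_ab_group_top_prod is_extension_prod assms)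
  show ?thesis
    by (intro extension_pushout.intro extension_pushout_axioms.intro top_extension.intro G H P.top_H
        P.is_extension_pullback cont_hom_diagonal cont_hom_mult)
qed

lemma is_extension_baer_sum:
  assumes "top_ab_group G" "top_ab_group H" "is_extension G H E1" "is_extension G H E2"
  shows "is_extension G H (baer_sum G H E1 E2)"
  unfolding baer_sum_def by (rule extension_pushout.is_extension_pushout[OF extension_pushout_baer[OF assms]])

text \<open>For \<open>A = G\<close> this says that the Baer sum is well defined on classes; for a subgroup \<open>A\<close> it is what
  makes restriction additive.\<close>

lemma ext_equiv_baer_sum:
  assumes A: "top_ab_group A" and G: "top_ab_group G" and H: "top_ab_group H"
    and AG: "(\<lambda>a. a) \<in> cont_hom A G"
    and E: "is_extension A H E1" "is_extension A H E2" and F: "is_extension G H F1" "is_extension G H F2"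
    and eq: "ext_equiv H E1 F1" "ext_equiv H E2 F2"
  shows "ext_equiv H (baer_sum A H E1 E2) (baer_sum G H F1 F2)"
proof -
  interpret AG: group_hom A G "\<lambda>a. a" by (rule cont_hom_group_hom[OF AG A G])
  have "carrier A \<subseteq> carrier G" using cont_homD(3)[OF AG] by blast
  then have "ext_equiv (top_prod H H) (ext_pullback A (\<lambda>g. (g, g)) (ext_prod E1 E2))
      (ext_pullback G (\<lambda>g. (g, g)) (ext_prod F1 F2))"
    using AG.hom_one by (intro ext_equiv_pullback ext_equiv_prod eq AG) auto
  then show ?thesis
    unfolding baer_sum_def
    by (rule ext_equiv_pushout[OF extension_pushout_baer[OF A H E] extension_pushout_baer[OF G H F]])
qed

section \<open>Classes of extensions\<close>

lemma ext_class_eqI: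
  assumes G: "top_ab_group G" and H: "top_ab_group H"
    and E: "is_extension G H E" and F: "is_extension G H F" and eq: "ext_equiv H E F"
  shows "ext_class G H E = ext_class G H F"
  using ext_equiv_trans[OF eq] ext_equiv_trans[OF ext_equiv_sym[OF G H E F eq]]
  by (auto simp: ext_class_def)

lemma ext_class_nonempty:
  assumes "top_ab_group G" "top_ab_group H" "is_extension G H E"
  obtains E' where "E' \<in> ext_class G H E"
  using extension_representative[OF assms] by (auto simp: ext_class_def)

lemma ext_class_eqD:
  assumes G: "top_ab_group G" and H: "top_ab_group H"
    and E: "is_extension G H E" and F: "is_extension G H F" and eq: "ext_class G H E = ext_class G H F"
  shows "ext_equiv H E F"
proof -
  obtain E' where "E' \<in> ext_class G H E" using ext_class_nonempty[OF G H E] .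
  then have "is_extension G H E'" "ext_equiv H E E'" "ext_equiv H F E'"
    using eq by (auto simp: ext_class_def)
  then show ?thesis using ext_equiv_trans ext_equiv_sym[OF G H F] by metis
qed

lemma ext_class_in_Ext:
  assumes G: "top_ab_group G" and H: "top_ab_group H" and E: "is_extension G H E"
  shows "ext_class G H E \<in> carrier (Ext G H)"
proof -
  obtain E' where "E' \<in> ext_class G H E" using ext_class_nonempty[OF G H E] .
  then have "is_extension G H E'" "ext_equiv H E E'" by (auto simp: ext_class_def)
  then show ?thesis using ext_class_eqI[OF G H E] by (auto simp: Ext_def)
qed

text \<open>Classes of extensions are nonempty even if the middle group of \<open>E\<close> lives in another type, so a
  union of sets that do not depend on the representative is just that set.\<close>

lemma ext_class_UN:
  assumes G: "top_ab_group G" and H: "top_ab_group H" and E: "is_extension G H E"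
    and c: "\<And>F. is_extension G H F \<Longrightarrow> ext_equiv H E F \<Longrightarrow> f F = S"
  shows "(\<Union>F\<in>ext_class G H E. f F) = S"
proof -
  obtain E' where E': "E' \<in> ext_class G H E" using ext_class_nonempty[OF G H E] .
  have "f F = S" if "F \<in> ext_class G H E" for F
    using c[of F] that by (auto simp: ext_class_def)
  then show ?thesis using E' by blast
qed

text \<open>The middle groups may live in any types, which is needed as Baer sums and pull-backs do not stay
  in the type of the representatives.\<close>

lemma mult_ext_class:
  assumes G: "top_ab_group G" and H: "top_ab_group H"
    and E1: "is_extension G H E1" and E2: "is_extension G H E2"
  shows "ext_class G H E1 \<otimes>\<^bsub>Ext G H\<^esub> ext_class G H E2 = ext_class G H (baer_sum G H E1 E2)"
proof -
  have "(\<Union>F1\<in>ext_class G H E1. \<Union>F2\<in>ext_class G H E2. ext_class G H (baer_sum G H F1 F2))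
      = ext_class G H (baer_sum G H E1 E2)"
  proof (intro ext_class_UN[OF G H E1] ext_class_UN[OF G H E2] ext_class_eqI[OF G H, symmetric])
    fix F1 F2 :: "('b, 'a) ext"
    assume F: "is_extension G H F1" "ext_equiv H E1 F1" "is_extension G H F2" "ext_equiv H E2 F2"
    show "is_extension G H (baer_sum G H F1 F2)" "is_extension G H (baer_sum G H E1 E2)"
      by (intro is_extension_baer_sum G H E1 E2 F)+
    show "ext_equiv H (baer_sum G H E1 E2) (baer_sum G H F1 F2)"
      by (intro ext_equiv_baer_sum[OF G G H cont_hom_id] E1 E2 F)
  qed
  then show ?thesis by (simp add: Ext_def)
qed

section \<open>Extensions by a divisible group\<close>

text \<open>As an extension of abstract groups, one with divisible kernel splits. Nothing is claimed about the
  continuity of \<open>r\<close>.\<close>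

lemma (in top_extension) divisible_retraction:
  assumes div: "divisible_group H"
  shows "\<exists>r\<in>hom X H. \<forall>h\<in>carrier H. r (i h) = h"
proof -
  have sub: "subgroup (kernel X G p) X" by (rule p.subgroup_kernel)
  have "coord \<in> hom (X\<lparr>carrier := kernel X G p\<rparr>) H"
    by (auto simp: hom_def kernel_def coord_closed coord_mult)
  from divisible_hom_extends[OF X.comm_group_axioms H.comm_group_axioms div sub this]
  obtain r where r: "r \<in> hom X H" "\<And>x. x \<in> kernel X G p \<Longrightarrow> r x = coord x" by blast
  have "r (i h) = h" if "h \<in> carrier H" for h
    using r(2)[of "i h"] that by (simp add: kernel_def)
  with r(1) show ?thesis by blast
qed

text \<open>In other words \<open>(r, p)\<close> is a bijection of \<open>X\<close> onto \<open>H \<times> G\<close>.\<close>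

lemma (in top_extension)
  assumes r: "r \<in> hom X H" and ri: "\<And>h. h \<in> carrier H \<Longrightarrow> r (i h) = h"
  shows splits_inj: "\<lbrakk>x \<in> carrier X; y \<in> carrier X; r x = r y; p x = p y\<rbrakk> \<Longrightarrow> x = y"
    and splits_surj: "\<lbrakk>h \<in> carrier H; g \<in> carrier G\<rbrakk> \<Longrightarrow> \<exists>x\<in>carrier X. r x = h \<and> p x = g"
proof -
  interpret r: group_hom X H r
    by (intro group_hom.intro group_hom_axioms.intro X.is_group H.is_group r)
  show "x = y" if xy: "x \<in> carrier X" "y \<in> carrier X" "r x = r y" "p x = p y"
  proof -
    let ?d = "x \<otimes>\<^bsub>X\<^esub> inv\<^bsub>X\<^esub> y"
    have d: "?d \<in> carrier X" "p ?d = \<one>\<^bsub>G\<^esub>" "r ?d = \<one>\<^bsub>H\<^esub>" using xy by simp_all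
    then have "coord ?d = \<one>\<^bsub>H\<^esub>" using ri[OF coord_closed[OF d(1,2)]] inc_coord[OF d(1,2)] by simp
    then have "?d = \<one>\<^bsub>X\<^esub>" using inc_coord[OF d(1,2)] by simp
    then have "x = inv\<^bsub>X\<^esub> (inv\<^bsub>X\<^esub> y)" using xy by (intro X.inv_equality[symmetric]) simp_all
    then show ?thesis using xy by simp
  qed
  show "\<exists>x\<in>carrier X. r x = h \<and> p x = g" if hg: "h \<in> carrier H" "g \<in> carrier G"
  proof -
    obtain x where x: "x \<in> carrier X" "p x = g" using prj_surj[OF hg(2)] .
    have "r (x \<otimes>\<^bsub>X\<^esub> i (inv\<^bsub>H\<^esub> r x \<otimes>\<^bsub>H\<^esub> h)) = r x \<otimes>\<^bsub>H\<^esub> (inv\<^bsub>H\<^esub> r x \<otimes>\<^bsub>H\<^esub> h)"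
      using x hg ri[of "inv\<^bsub>H\<^esub> r x \<otimes>\<^bsub>H\<^esub> h"] r.hom_mult[of x "i (inv\<^bsub>H\<^esub> r x \<otimes>\<^bsub>H\<^esub> h)"]
      by (simp del: i.hom_mult)
    also have "\<dots> = h" using x hg by (simp flip: H.m_assoc)
    finally show ?thesis
      using x hg prj_inc[of "inv\<^bsub>H\<^esub> r x \<otimes>\<^bsub>H\<^esub> h"]
      by (intro bexI[of _ "x \<otimes>\<^bsub>X\<^esub> i (inv\<^bsub>H\<^esub> r x \<otimes>\<^bsub>H\<^esub> h)"]) (simp_all del: i.hom_mult)
  qed
qed

section \<open>Restriction to an open subgroup\<close>

lemma continuous_map_if_on_open_subgroup:
  assumes X: "top_ab_group X" and K: "top_ab_group K" and f: "f \<in> hom X K"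
    and Y: "openin (topol X) Y" "\<one>\<^bsub>X\<^esub> \<in> Y"
    and c: "continuous_map (subtopology (topol X) Y) (topol K) f"
  shows "continuous_map (topol X) (topol K) f"
  unfolding continuous_map_def
proof (intro conjI allI impI)
  interpret f: group_hom X K f
    using X K f by (simp add: group_hom_def group_hom_axioms_def top_ab_groupD)
  have tX: "topspace (topol X) = carrier X" and tK: "topspace (topol K) = carrier K"
    using X K by (simp_all add: top_ab_groupD)
  show "f \<in> topspace (topol X) \<rightarrow> topspace (topol K)" by (simp add: tX tK)
  fix U assume U: "openin (topol K) U"
  show "openin (topol X) {x \<in> topspace (topol X). f x \<in> U}"
  proof (subst openin_subopen, intro ballI)
    fix x assume "x \<in> {x \<in> topspace (topol X). f x \<in> U}"
    then have x: "x \<in> carrier X" "f x \<in> U" by (simp_all add: tX)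
    \<comment> \<open>Near \<open>x\<close> the map is a translate of its restriction to \<open>Y\<close>.\<close>
    let ?V = "{y \<in> topspace (subtopology (topol X) Y). f x \<otimes>\<^bsub>K\<^esub> f y \<in> U}"
    let ?W = "{z \<in> topspace (topol X). inv\<^bsub>X\<^esub> x \<otimes>\<^bsub>X\<^esub> z \<in> ?V}"
    have "openin (subtopology (topol X) Y) ?V"
      using x by (intro openin_continuous_map_preimage[OF continuous_map_group_mult[OF K] U] c)
        (simp add: tK)
    then have "openin (topol X) ?V" using Y(1) by (rule openin_trans_full)
    then have "openin (topol X) ?W"
      using x by (intro openin_continuous_map_preimage[OF continuous_map_group_mult[OF X]])
        (simp_all add: tX continuous_map_id[unfolded id_def])
    moreover have "x \<in> ?W" using x Y(2) by (simp add: tX)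
    moreover have "?W \<subseteq> {x \<in> topspace (topol X). f x \<in> U}"
    proof
      fix z assume "z \<in> ?W"
      then have z: "z \<in> carrier X" "f x \<otimes>\<^bsub>K\<^esub> f (inv\<^bsub>X\<^esub> x \<otimes>\<^bsub>X\<^esub> z) \<in> U" by (simp_all add: tX)
      have "f x \<otimes>\<^bsub>K\<^esub> f (inv\<^bsub>X\<^esub> x \<otimes>\<^bsub>X\<^esub> z) = f (x \<otimes>\<^bsub>X\<^esub> (inv\<^bsub>X\<^esub> x \<otimes>\<^bsub>X\<^esub> z))" using x z by simp
      also have "x \<otimes>\<^bsub>X\<^esub> (inv\<^bsub>X\<^esub> x \<otimes>\<^bsub>X\<^esub> z) = z" using x z by (simp flip: f.G.m_assoc)
      finally show "z \<in> {x \<in> topspace (topol X). f x \<in> U}" using z by (simp add: tX)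
    qed
    ultimately show "\<exists>T. openin (topol X) T \<and> x \<in> T \<and> T \<subseteq> {x \<in> topspace (topol X). f x \<in> U}" by blast
  qed
qed

abbreviation ext_restrict :: "'g top_group \<Rightarrow> 'g set \<Rightarrow> ('h, 'x, 'g) extension \<Rightarrow> ('h, 'x \<times> 'g, 'g) extension"
  where "ext_restrict G A \<equiv> ext_pullback (top_subgroup G A) (\<lambda>a. a)"

lemma ext_equiv_restrict_self: "ext_equiv H (ext_restrict G A E) E"
proof -
  have "fst \<in> cont_hom (mid (ext_restrict G A E)) (mid E)"
    by (auto simp: cont_hom_def hom_def continuous_map_from_subtopology continuous_map_fst)
  then show ?thesis unfolding ext_equiv_def by (rule bexI[rotated]) auto
qed

text \<open>The restriction is the universal extension of \<open>A\<close> with a morphism to \<open>E\<close> over the inclusion.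
  With the symmetry of equivalence, the existence of such a morphism from \<open>F\<close> to \<open>E\<close> identifies \<open>F\<close>, up to
  equivalence, with the restriction of \<open>E\<close>.\<close>

lemma ext_equiv_restrict_universal:
  assumes G: "top_ab_group G" and A: "subgroup A G" and H: "top_ab_group H"
    and F: "is_extension (top_subgroup G A) H F" and eq: "ext_equiv H F E"
  shows "ext_equiv H F (ext_restrict G A E)"
proof -
  interpret F: top_extension "top_subgroup G A" H F
    by (intro top_extension.intro top_ab_group_top_subgroup G A H F)
  obtain T where T: "T \<in> cont_hom F.X (mid E)"
    "\<And>h. h \<in> carrier H \<Longrightarrow> T (F.i h) = inc E h" "\<And>x. x \<in> carrier F.X \<Longrightarrow> prj E (T x) = F.p x"
    using eq unfolding ext_equiv_def by blast
  let ?T = "\<lambda>x. (T x, F.p x)"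
  have "F.p x \<in> A" if "x \<in> carrier F.X" for x using F.p.hom_closed[OF that] by simp
  then have "?T \<in> cont_hom F.X (mid (ext_restrict G A E))"
    using cont_homD(2-4)[OF T(1)] cont_homD(2)[OF F.p_hom] T(3)
    by (auto simp: cont_hom_def hom_def continuous_map_in_subtopology continuous_map_paired)
  then show ?thesis
    unfolding ext_equiv_def by (rule bexI[rotated]) (auto simp: T F.prj_inc[simplified])
qed

text \<open>This gives injectivity. Let \<open>T\<close> be a morphism to \<open>E2\<close> defined on the open subgroup \<open>Y\<close> of \<open>E1\<close>
  lying over \<open>A\<close>, and let \<open>r2\<close> be an abstract retraction of \<open>E2\<close> onto \<open>H\<close>. The homomorphism
  \<open>r2 \<circ> T\<close> from \<open>Y\<close> to \<open>H\<close> extends to all of \<open>E1\<close>; and a homomorphism to \<open>E2\<close> over \<open>G\<close> is the same as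
  its composite with \<open>r2\<close>, because \<open>E2\<close> is \<open>H \<times> G\<close> as an abstract group. So \<open>T\<close> extends to a
  homomorphism over \<open>G\<close>, which is continuous because it is so on the open subgroup \<open>Y\<close>.\<close>

lemma ext_equiv_if_restrict:
  assumes G: "top_ab_group G" and H: "top_ab_group H" and div: "divisible_group H"
    and A: "subgroup A G" "openin (topol G) A"
    and E1: "is_extension G H E1" and E2: "is_extension G H E2"
    and eq: "ext_equiv H (ext_restrict G A E1) E2"
  shows "ext_equiv H E1 E2"
proof -
  interpret E1: top_extension G H E1 by (intro top_extension.intro G H E1)
  interpret E2: top_extension G H E2 by (intro top_extension.intro G H E2)
  interpret A: subgroup A G by (rule A)
  define Y where "Y = {x \<in> topspace (topol E1.X). E1.p x \<in> A}"
  have Yo: "openin (topol E1.X) Y"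
    unfolding Y_def by (rule openin_continuous_map_preimage[OF cont_homD(2)[OF E1.p_hom] A(2)])
  have Y: "x \<in> Y \<longleftrightarrow> x \<in> carrier E1.X \<and> E1.p x \<in> A" for x by (simp add: Y_def)
  have Ysub: "subgroup Y E1.X"
  proof (rule E1.X.subgroupI)
    have "\<one>\<^bsub>E1.X\<^esub> \<in> Y" by (simp add: Y)
    then show "Y \<noteq> {}" by blast
  qed (auto simp: Y)
  obtain T where T: "T \<in> cont_hom (mid (ext_restrict G A E1)) E2.X"
    and Ti: "\<And>h. h \<in> carrier H \<Longrightarrow> T (E1.i h, \<one>\<^bsub>G\<^esub>) = E2.i h"
    and Tp: "\<And>z. z \<in> carrier (mid (ext_restrict G A E1)) \<Longrightarrow> E2.p (T z) = snd z"
    using eq unfolding ext_equiv_def by auto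
  define S where "S x = T (x, E1.p x)" for x
  have Yz: "(x, E1.p x) \<in> carrier (mid (ext_restrict G A E1))" if "x \<in> Y" for x
    using that by (simp add: Y)
  have S: "S x \<in> carrier E2.X" "E2.p (S x) = E1.p x" if "x \<in> Y" for x
    using cont_homD(3)[OF T Yz[OF that]] Tp[OF Yz[OF that]] by (simp_all add: S_def)
  have Sm: "S (x \<otimes>\<^bsub>E1.X\<^esub> y) = S x \<otimes>\<^bsub>E2.X\<^esub> S y" if "x \<in> Y" "y \<in> Y" for x y
    using cont_homD(4)[OF T Yz[OF that(1)] Yz[OF that(2)]] that by (simp add: S_def Y)
  have cS: "continuous_map (subtopology (topol E1.X) Y) (topol E2.X) S"
  proof -
    have "continuous_map (subtopology (topol E1.X) Y) (topol (mid (ext_restrict G A E1))) (\<lambda>x. (x, E1.p x))"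
      using cont_homD(2)[OF E1.p_hom] Y
      by (auto simp: continuous_map_in_subtopology continuous_map_paired
          intro!: continuous_map_from_subtopology continuous_map_id[unfolded id_def])
    from continuous_map_compose[OF this cont_homD(2)[OF T]] show ?thesis
      by (simp add: o_def S_def[abs_def])
  qed
  obtain r2 where r2: "r2 \<in> hom E2.X H" "\<And>h. h \<in> carrier H \<Longrightarrow> r2 (E2.i h) = h"
    using E2.divisible_retraction[OF div] by blast
  have "(\<lambda>x. r2 (S x)) \<in> hom (E1.X\<lparr>carrier := Y\<rparr>) H"
    using r2(1) S(1) Sm by (auto simp: hom_def)
  from divisible_hom_extends[OF E1.X.comm_group_axioms E1.H.comm_group_axioms div Ysub this]
  obtain r1 where r1: "r1 \<in> hom E1.X H" "\<And>x. x \<in> Y \<Longrightarrow> r1 x = r2 (S x)" by blast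
  define U where "U x = (SOME y. y \<in> carrier E2.X \<and> r2 y = r1 x \<and> E2.p y = E1.p x)" for x
  have r1c: "r1 x \<in> carrier H" if "x \<in> carrier E1.X" for x using r1(1) that by (auto simp: hom_def)
  have U: "U x \<in> carrier E2.X \<and> r2 (U x) = r1 x \<and> E2.p (U x) = E1.p x" if "x \<in> carrier E1.X" for x
  proof -
    have "\<exists>y. y \<in> carrier E2.X \<and> r2 y = r1 x \<and> E2.p y = E1.p x"
      using E2.splits_surj[OF r2 r1c[OF that] E1.p.hom_closed[OF that]] by blast
    then show ?thesis unfolding U_def by (rule someI_ex)
  qed
  have uniq: "y = U x" if "x \<in> carrier E1.X" "y \<in> carrier E2.X" "r2 y = r1 x" "E2.p y = E1.p x" for x y
    using E2.splits_inj[OF r2] U[OF that(1)] that by metis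
  have US: "U x = S x" if "x \<in> Y" for x
    using uniq[of x "S x"] S[OF that] r1(2)[OF that] that by (simp add: Y)
  have Uhom: "U \<in> hom E1.X E2.X"
  proof (rule homI)
    fix x y assume xy: "x \<in> carrier E1.X" "y \<in> carrier E1.X"
    have "U x \<otimes>\<^bsub>E2.X\<^esub> U y = U (x \<otimes>\<^bsub>E1.X\<^esub> y)"
      using U[OF xy(1)] U[OF xy(2)] xy r2(1) r1(1) by (intro uniq) (auto simp: hom_def)
    then show "U (x \<otimes>\<^bsub>E1.X\<^esub> y) = U x \<otimes>\<^bsub>E2.X\<^esub> U y" ..
  qed (use U in blast)
  have "continuous_map (topol E1.X) (topol E2.X) U"
  proof (rule continuous_map_if_on_open_subgroup[OF E1.top_X E2.top_X Uhom Yo])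
    show "\<one>\<^bsub>E1.X\<^esub> \<in> Y" by (rule subgroup.one_closed[OF Ysub])
    show "continuous_map (subtopology (topol E1.X) Y) (topol E2.X) U"
      by (rule continuous_map_eq[OF cS]) (simp add: US)
  qed
  with Uhom have "U \<in> cont_hom E1.X E2.X" by (simp add: cont_hom_def)
  moreover have "U (E1.i h) = E2.i h" if "h \<in> carrier H" for h
    using US[of "E1.i h"] Ti[OF that] that by (simp add: Y S_def)
  ultimately show ?thesis using U unfolding ext_equiv_def by blast
qed

text \<open>This gives surjectivity. As an abstract group the middle group \<open>Y\<close> of \<open>F\<close> is \<open>H \<times> A\<close>, a subgroup of
  \<open>H \<times> G\<close>, and \<open>H \<times> G\<close> should carry the group topology in which \<open>Y\<close> is open. It is obtained as a
  quotient: with \<open>G\<close> taken discrete, \<open>Y \<times> G\<close> maps onto \<open>H \<times> G\<close> by \<open>q (y, g) = (r y, p y + g)\<close>. The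
  kernel is closed although \<open>r\<close> is not continuous, because each of its slices over a point \<open>g\<close> is
  finite.\<close>

lemma extension_from_open_subgroup:
  fixes G :: "'g top_group" and H :: "'h top_group"
  assumes G: "top_ab_group G" and H: "top_ab_group H" and div: "divisible_group H"
    and A: "subgroup A G" "openin (topol G) A"
    and F: "is_extension (top_subgroup G A) H F"
  shows "\<exists>E :: ('h, 'g) ext. is_extension G H E \<and> ext_equiv H F E"
proof -
  interpret F: top_extension "top_subgroup G A" H F
    by (intro top_extension.intro top_ab_group_top_subgroup G A H F)
  interpret A: subgroup A G by (rule A)
  interpret G: comm_group G using G by (rule top_ab_groupD)
  have tG: "topspace (topol G) = carrier G" using G by (rule top_ab_groupD)
  have pA: "F.p y \<in> A" if "y \<in> carrier F.X" for y using F.p.hom_closed[OF that] by simp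
  then have pG: "F.p y \<in> carrier G" if "y \<in> carrier F.X" for y using that by simp
  have pm: "F.p (y \<otimes>\<^bsub>F.X\<^esub> z) = F.p y \<otimes>\<^bsub>G\<^esub> F.p z" if "y \<in> carrier F.X" "z \<in> carrier F.X" for y z
    using F.p.hom_mult[OF that] by simp
  obtain r where r: "r \<in> hom F.X H" "\<And>h. h \<in> carrier H \<Longrightarrow> r (F.i h) = h"
    using F.divisible_retraction[OF div] by blast
  have rH: "r y \<in> carrier H" if "y \<in> carrier F.X" for y using r(1) that by (auto simp: hom_def)
  define D where "D = with_topology G (discrete_topology (carrier G))"
  have D: "top_ab_group D"
    unfolding top_ab_group_def D_def
    by (auto simp: comm_group_with_topology[OF G.comm_group_axioms] simp flip: prod_topology_discrete_topology)
  let ?P = "top_prod F.X D"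
  have P: "top_ab_group ?P" by (rule top_ab_group_top_prod[OF F.top_X D])
  have tP: "topspace (topol ?P) = carrier F.X \<times> carrier G" by (simp add: D_def)
  have cP: "carrier ?P = carrier F.X \<times> carrier G" by (simp add: D_def)
  define q where "q z = (r (fst z), F.p (fst z) \<otimes>\<^bsub>G\<^esub> snd z)" for z
  let ?M = "H \<times>\<times> G"
  have M: "comm_group ?M" by (rule comm_group_DirProd[OF F.H.comm_group_axioms G.comm_group_axioms])
  have q: "q \<in> hom ?P ?M"
  proof (rule homI)
    fix x y assume xy: "x \<in> carrier ?P" "y \<in> carrier ?P"
    then have *: "fst x \<in> carrier F.X" "snd x \<in> carrier G" "fst y \<in> carrier F.X" "snd y \<in> carrier G"
      unfolding cP by auto
    have "r (fst x \<otimes>\<^bsub>F.X\<^esub> fst y) = r (fst x) \<otimes>\<^bsub>H\<^esub> r (fst y)" using r(1) * by (auto simp: hom_def)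
    then show "q (x \<otimes>\<^bsub>?P\<^esub> y) = q x \<otimes>\<^bsub>?M\<^esub> q y"
      using * pG by (simp add: q_def mult_top_prod D_def pm G.m_ac)
  qed (auto simp: q_def rH pG D_def)
  have qi: "q (F.i h, g) = (h, g)" if "h \<in> carrier H" "g \<in> carrier G" for h g
    using that r(2) F.prj_inc[of h] by (simp add: q_def)
  have qsur: "q ` carrier ?P = carrier ?M"
  proof (intro equalityI)
    show "q ` carrier ?P \<subseteq> carrier ?M" using hom_carrier[OF q] .
    show "carrier ?M \<subseteq> q ` carrier ?P"
    proof
      fix z assume "z \<in> carrier ?M"
      then obtain h g where "h \<in> carrier H" "g \<in> carrier G" "z = (h, g)" by auto
      then show "z \<in> q ` carrier ?P"
        using qi by (intro image_eqI[of _ _ "(F.i h, g)"]) (simp_all add: D_def)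
    qed
  qed
  have kcl: "closedin (topol ?P) (kernel ?P ?M q)"
    unfolding closedin_def
  proof (intro conjI)
    show "kernel ?P ?M q \<subseteq> topspace (topol ?P)" unfolding tP kernel_def cP by blast
    show "openin (topol ?P) (topspace (topol ?P) - kernel ?P ?M q)"
      unfolding top_prod_simps(4) openin_prod_topology_alt
    proof (intro allI impI)
      fix y g assume "(y, g) \<in> topspace (prod_topology (topol F.X) (topol D)) - kernel ?P ?M q"
      then have yg: "y \<in> carrier F.X" "g \<in> carrier G" "(y, g) \<notin> kernel ?P ?M q" by (auto simp: D_def)
      \<comment> \<open>Over a fixed \<open>g\<close> the kernel has at most one point, as \<open>r\<close> and \<open>p\<close> jointly separate points.\<close>
      define Z where "Z = {z \<in> carrier F.X. (z, g) \<in> kernel ?P ?M q}"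
      have "u = v" if "u \<in> Z" "v \<in> Z" for u v
      proof (rule F.splits_inj[OF r])
        show "r u = r v" "u \<in> carrier F.X" "v \<in> carrier F.X" using that by (auto simp: Z_def kernel_def q_def)
        have "F.p u \<otimes>\<^bsub>G\<^esub> g = F.p v \<otimes>\<^bsub>G\<^esub> g" using that by (auto simp: Z_def kernel_def q_def)
        then show "F.p u = F.p v" using yg that pG by (simp add: Z_def)
      qed
      then have "finite Z" by (metis finite.simps is_singletonI' is_singleton_def)
      then have "closedin (topol F.X) Z"
        using F.top_X by (intro closedin_Hausdorff_finite) (auto simp: top_ab_groupD Z_def)
      then have "openin (topol F.X) (topspace (topol F.X) - Z)" by (rule openin_diff[OF openin_topspace])
      moreover have "openin (topol D) {g}" using yg by (simp add: D_def)
      moreover have "y \<in> topspace (topol F.X) - Z" using yg by (simp add: Z_def)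
      moreover have "(topspace (topol F.X) - Z) \<times> {g}
          \<subseteq> topspace (prod_topology (topol F.X) (topol D)) - kernel ?P ?M q"
        using yg by (auto simp: Z_def D_def)
      ultimately show "\<exists>U V. openin (topol F.X) U \<and> openin (topol D) V \<and> y \<in> U \<and> g \<in> V \<and>
          U \<times> V \<subseteq> topspace (prod_topology (topol F.X) (topol D)) - kernel ?P ?M q" by blast
    qed
  qed
  let ?Q = "quotient_topology (topol ?P) q"
  let ?X = "with_topology ?M ?Q"
  have X: "top_ab_group ?X" by (rule top_ab_group_quotient[OF P M q qsur kcl])
  have cq: "continuous_map (topol ?P) ?Q q"
    by (rule quotient_imp_continuous_map[OF quotient_map_quotient_topology])
  have oq: "open_map (topol ?P) ?Q q"
    by (rule open_map_quotient_topology[OF P _ q]) (use M in \<open>simp add: comm_group_def\<close>)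
  have tQ: "topspace ?Q = carrier H \<times> carrier G" using qsur tP cP by (simp add: D_def)
  have pc: "continuous_map (topol F.X) (topol G) F.p"
    using cont_homD(2)[OF F.p_hom] by (simp add: continuous_map_in_subtopology)
  have slice: "continuous_map (topol F.X) (topol ?P) (\<lambda>y. (y, \<one>\<^bsub>G\<^esub>))"
    by (simp add: continuous_map_paired continuous_map_id[unfolded id_def] D_def)
  have po: "open_map (topol F.X) (topol G) F.p"
    unfolding open_map_def
  proof (intro allI impI)
    fix U assume "openin (topol F.X) U"
    then have "openin (subtopology (topol G) A) (F.p ` U)" using F.open_map_prj by (simp add: open_map_def)
    then show "openin (topol G) (F.p ` U)" using A(2) by (rule openin_trans_full)
  qed
  define E :: "('h, 'g) ext" where "E = \<lparr>mid = ?X, inc = (\<lambda>h. (h, \<one>\<^bsub>G\<^esub>)), prj = snd\<rparr>"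
  have E: "mid E = ?X" "inc E = (\<lambda>h. (h, \<one>\<^bsub>G\<^esub>))" "prj E = snd" by (simp_all add: E_def)
  have "is_extension G H E"
  proof (rule is_extensionI[OF G H, where j = fst], unfold E)
    show "top_ab_group ?X" by (rule X)
    show "(\<lambda>h. (h, \<one>\<^bsub>G\<^esub>)) \<in> cont_hom H ?X"
    proof -
      have "continuous_map (topol H) ?Q (q \<circ> ((\<lambda>y. (y, \<one>\<^bsub>G\<^esub>)) \<circ> F.i))"
        by (rule continuous_map_compose[OF continuous_map_compose[OF cont_homD(2)[OF F.i_hom] slice] cq])
      then have "continuous_map (topol H) ?Q (\<lambda>h. (h, \<one>\<^bsub>G\<^esub>))"
        by (rule continuous_map_eq) (simp add: qi)
      then show ?thesis by (auto simp: cont_hom_def hom_def)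
    qed
    show "snd \<in> cont_hom ?X G"
    proof -
      have "continuous_map (topol ?P) (topol G) (\<lambda>z. F.p (fst z) \<otimes>\<^bsub>G\<^esub> snd z)"
      proof (rule continuous_map_group_mult[OF G])
        show "continuous_map (topol ?P) (topol G) (\<lambda>z. F.p (fst z))"
          using continuous_map_compose[OF continuous_map_fst pc] by (simp add: o_def)
        have "continuous_map (topol D) (topol G) (\<lambda>g. g)" by (simp add: D_def tG)
        from continuous_map_compose[OF continuous_map_snd this]
        show "continuous_map (topol ?P) (topol G) snd" by (simp add: o_def)
      qed
      then have "continuous_map (topol ?P) (topol G) (snd \<circ> q)" by (simp add: o_def q_def)
      then have "continuous_map ?Q (topol G) snd"
        by (rule continuous_compose_quotient_map[OF quotient_map_quotient_topology])
      then show ?thesis by (auto simp: cont_hom_def hom_def)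
    qed
    show "continuous_map (subtopology (topol ?X) (kernel ?X G snd)) (topol H) fst"
      unfolding continuous_map_def
    proof (intro conjI allI impI)
      show "fst \<in> topspace (subtopology (topol ?X) (kernel ?X G snd)) \<rightarrow> topspace (topol H)"
        unfolding topspace_subtopology with_topology_simps tQ by auto
      fix U assume U: "openin (topol H) U"
      have UH: "U \<subseteq> carrier H" using openin_subset[OF U] by simp
      obtain W where W: "openin (topol F.X) W" "F.i ` U = W \<inter> kernel F.X (top_subgroup G A) F.p"
        using F.i_open U by (auto simp: open_onto_image_def open_map_def openin_subtopology F.i_image)
      have WX: "W \<subseteq> carrier F.X" using openin_subset[OF W(1)] by simp
      \<comment> \<open>The image of \<open>W\<close> under the open embedding of \<open>Y\<close> cuts out the image of \<open>U\<close>.\<close>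
      let ?W = "q ` (W \<times> {\<one>\<^bsub>G\<^esub>})"
      have "openin (topol ?P) (W \<times> {\<one>\<^bsub>G\<^esub>})"
        using W(1) by (simp add: openin_prod_Times_iff D_def)
      then have "openin ?Q ?W" using oq by (simp add: open_map_def)
      moreover have "{x \<in> topspace (subtopology ?Q (kernel ?X G snd)). fst x \<in> U} = ?W \<inter> kernel ?X G snd"
      proof (intro equalityI subsetI)
        fix x assume "x \<in> {x \<in> topspace (subtopology ?Q (kernel ?X G snd)). fst x \<in> U}"
        then have x: "x \<in> kernel ?X G snd" "fst x \<in> U" by auto
        then have "x = q (F.i (fst x), \<one>\<^bsub>G\<^esub>)" using UH by (auto simp: kernel_def qi prod_eq_iff)
        moreover have "F.i (fst x) \<in> W" using x W(2) by blast
        ultimately show "x \<in> ?W \<inter> kernel ?X G snd" using x by blast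
      next
        fix x assume x: "x \<in> ?W \<inter> kernel ?X G snd"
        then obtain w where w: "w \<in> W" "x = q (w, \<one>\<^bsub>G\<^esub>)" by blast
        then have wX: "w \<in> carrier F.X" using WX by blast
        have "F.p w = \<one>\<^bsub>G\<^esub>" using x w wX pG by (simp add: kernel_def q_def)
        then have "w \<in> F.i ` U" unfolding W(2) using w wX by (simp add: kernel_def)
        then have "fst x \<in> U" using w UH r(2) by (auto simp: q_def)
        moreover have "x \<in> topspace ?Q" using openin_subset[OF \<open>openin ?Q ?W\<close>] x by blast
        ultimately show "x \<in> {x \<in> topspace (subtopology ?Q (kernel ?X G snd)). fst x \<in> U}"
          using x unfolding topspace_subtopology by blast
      qed
      ultimately show "openin (subtopology (topol ?X) (kernel ?X G snd))
          {x \<in> topspace (subtopology (topol ?X) (kernel ?X G snd)). fst x \<in> U}"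
        unfolding with_topology_simps openin_subtopology by blast
    qed
    show "open_map (topol ?X) (topol G) snd"
      unfolding open_map_def with_topology_simps
    proof (intro allI impI)
      fix U assume U: "openin ?Q U"
      let ?V = "{z \<in> topspace (topol ?P). q z \<in> U}"
      have V: "openin (topol ?P) ?V" by (rule openin_continuous_map_preimage[OF cq U])
      show "openin (topol G) (snd ` U)"
      proof (subst openin_subopen, intro ballI)
        fix a assume "a \<in> snd ` U"
        then obtain u where u: "u \<in> U" "a = snd u" by blast
        then have "u \<in> q ` topspace (topol ?P)" using openin_subset[OF U] by auto
        then obtain y g where yg: "(y, g) \<in> ?V" "u = q (y, g)" using u by auto
        then have "(y, g) \<in> carrier F.X \<times> carrier G" unfolding tP by blast
        then have y: "y \<in> carrier F.X" "g \<in> carrier G" by simp_all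
        obtain B C where BC: "openin (topol F.X) B" "g \<in> C" "y \<in> B" "B \<times> C \<subseteq> ?V"
          using V yg(1) unfolding top_prod_simps(4) openin_prod_topology_alt by meson
        \<comment> \<open>With \<open>g\<close> fixed and \<open>b\<close> ranging over \<open>B\<close>, the second coordinate of \<open>q (b, g)\<close> sweeps out
          a translate of the open set \<open>p B\<close>.\<close>
        let ?W = "{z \<in> topspace (topol G). z \<otimes>\<^bsub>G\<^esub> inv\<^bsub>G\<^esub> g \<in> F.p ` B}"
        have "openin (topol G) (F.p ` B)" using po BC(1) by (simp add: open_map_def)
        then have "openin (topol G) ?W"
          using y by (intro openin_continuous_map_preimage[OF continuous_map_group_mult[OF G]])
            (simp_all add: tG continuous_map_id[unfolded id_def])
        moreover have "a \<in> ?W"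
          using u yg(2) y pG BC(3) by (simp add: q_def tG G.m_assoc)
        moreover have "?W \<subseteq> snd ` U"
        proof
          fix z assume "z \<in> ?W"
          then obtain b where z: "z \<in> carrier G" "b \<in> B" "z \<otimes>\<^bsub>G\<^esub> inv\<^bsub>G\<^esub> g = F.p b" by (auto simp: tG)
          have "F.p b \<otimes>\<^bsub>G\<^esub> g = z" using z(1) y by (simp add: G.m_assoc flip: z(3))
          then have "z = snd (q (b, g))" by (simp add: q_def)
          moreover have "q (b, g) \<in> U" using BC z(2) by auto
          ultimately show "z \<in> snd ` U" by blast
        qed
        ultimately show "\<exists>T. openin (topol G) T \<and> a \<in> T \<and> T \<subseteq> snd ` U" by blast
      qed
    qed
    show "\<exists>x\<in>carrier ?X. snd x = g" if "g \<in> carrier G" for g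
      using that F.H.one_closed by (intro bexI[of _ "(\<one>\<^bsub>H\<^esub>, g)"]) simp_all
  qed auto
  moreover have "ext_equiv H F E"
    unfolding ext_equiv_def
  proof (intro bexI conjI ballI)
    let ?T = "\<lambda>y. q (y, \<one>\<^bsub>G\<^esub>)"
    show "?T (F.i h) = inc E h" if "h \<in> carrier H" for h using that by (simp add: qi E)
    show "prj E (?T y) = F.p y" if "y \<in> carrier F.X" for y using pG[OF that] by (simp add: q_def E)
    have "?T \<in> hom F.X ?X"
      using r(1) pG pm rH by (auto simp: hom_def q_def)
    moreover have "continuous_map (topol F.X) ?Q ?T"
      using continuous_map_compose[OF slice cq] by (simp add: o_def)
    ultimately show "?T \<in> cont_hom F.X (mid E)" by (simp add: cont_hom_def E)
  qed
  ultimately show ?thesis by blast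
qed

lemma is_extension_restrict:
  assumes G: "top_ab_group G" and H: "top_ab_group H" and A: "subgroup A G" and E: "is_extension G H E"
  shows "is_extension (top_subgroup G A) H (ext_restrict G A E)"
proof -
  interpret top_extension G H E by (intro top_extension.intro G H E)
  show ?thesis
    by (intro is_extension_pullback top_ab_group_top_subgroup top_subgroup_cont_hom G A subgroup.subset)
qed

text \<open>The union runs over equal sets by \<open>restrict_ext_class\<close> below.\<close>

definition restrict_class ::
    "'g top_group \<Rightarrow> 'h top_group \<Rightarrow> 'g set \<Rightarrow> ('h, 'g) ext set \<Rightarrow> ('h, 'g) ext set" where
  "restrict_class G H A C = (\<Union>E\<in>C. ext_class (top_subgroup G A) H (ext_restrict G A E))"

lemma restrict_ext_class:
  assumes G: "top_ab_group G" and H: "top_ab_group H" and A: "subgroup A G" and E: "is_extension G H E"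
  shows "restrict_class G H A (ext_class G H E) = ext_class (top_subgroup G A) H (ext_restrict G A E)"
  unfolding restrict_class_def
proof (rule ext_class_UN[OF G H E])
  fix F :: "('b, 'a) ext" assume F: "is_extension G H F" "ext_equiv H E F"
  have "ext_equiv H (ext_restrict G A E) (ext_restrict G A F)"
    by (intro ext_equiv_restrict_universal G A H is_extension_restrict E
        ext_equiv_trans[OF ext_equiv_restrict_self F(2)])
  then show "ext_class (top_subgroup G A) H (ext_restrict G A F) = ext_class (top_subgroup G A) H (ext_restrict G A E)"
    by (intro ext_class_eqI[symmetric] top_ab_group_top_subgroup is_extension_restrict G H A E F(1))
qed

section \<open>The restriction isomorphism\<close>

theorem theorem14:
  fixes G :: "'g top_group" and H :: "'h top_group" and A :: "'g set"
  assumes "top_ab_group G" and "top_ab_group H"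
    and "divisible_group H"
    and "subgroup A G" and "openin (topol G) A"
  shows "Ext G H \<cong> Ext (top_subgroup G A) H"
proof -
  note G = assms(1) and H = assms(2) and A = assms(4)
  let ?A = "top_subgroup G A"
  have tA: "top_ab_group ?A" by (rule top_ab_group_top_subgroup[OF G A])
  note res = is_extension_restrict[OF G H A]
  have elim: "\<exists>E :: ('h, 'g) ext. is_extension G H E \<and> C = ext_class G H E" if "C \<in> carrier (Ext G H)" for C
    using that by (auto simp: Ext_def)
  have hom: "restrict_class G H A \<in> hom (Ext G H) (Ext ?A H)"
  proof (rule homI)
    fix C assume "C \<in> carrier (Ext G H)"
    from elim[OF this] obtain E :: "('h, 'g) ext" where E: "is_extension G H E" "C = ext_class G H E" by blast
    show "restrict_class G H A C \<in> carrier (Ext ?A H)"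
      unfolding E(2) restrict_ext_class[OF G H A E(1)] by (rule ext_class_in_Ext[OF tA H res[OF E(1)]])
  next
    fix C D assume CD: "C \<in> carrier (Ext G H)" "D \<in> carrier (Ext G H)"
    obtain E :: "('h, 'g) ext" where E: "is_extension G H E" "C = ext_class G H E" using elim[OF CD(1)] by blast
    obtain F :: "('h, 'g) ext" where F: "is_extension G H F" "D = ext_class G H F" using elim[OF CD(2)] by blast
    let ?B = "baer_sum G H E F"
    have B: "is_extension G H ?B" by (rule is_extension_baer_sum[OF G H E(1) F(1)])
    have B': "is_extension ?A H (baer_sum ?A H (ext_restrict G A E) (ext_restrict G A F))"
      by (rule is_extension_baer_sum[OF tA H res[OF E(1)] res[OF F(1)]])
    have "ext_equiv H (baer_sum ?A H (ext_restrict G A E) (ext_restrict G A F)) ?B"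
      by (rule ext_equiv_baer_sum[OF tA G H top_subgroup_cont_hom[OF subgroup.subset[OF A]]
            res[OF E(1)] res[OF F(1)] E(1) F(1) ext_equiv_restrict_self ext_equiv_restrict_self])
    then have "ext_equiv H (baer_sum ?A H (ext_restrict G A E) (ext_restrict G A F)) (ext_restrict G A ?B)"
      by (rule ext_equiv_restrict_universal[OF G A H B'])
    then show "restrict_class G H A (C \<otimes>\<^bsub>Ext G H\<^esub> D)
        = restrict_class G H A C \<otimes>\<^bsub>Ext ?A H\<^esub> restrict_class G H A D"
      unfolding E(2) F(2) mult_ext_class[OF G H E(1) F(1)] restrict_ext_class[OF G H A B]
        restrict_ext_class[OF G H A E(1)] restrict_ext_class[OF G H A F(1)]
        mult_ext_class[OF tA H res[OF E(1)] res[OF F(1)]]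
      by (intro ext_class_eqI[OF tA H B' res[OF B], symmetric])
  qed
  have inj: "inj_on (restrict_class G H A) (carrier (Ext G H))"
  proof (rule inj_onI)
    fix C D assume CD: "C \<in> carrier (Ext G H)" "D \<in> carrier (Ext G H)"
      and eq: "restrict_class G H A C = restrict_class G H A D"
    obtain E :: "('h, 'g) ext" where E: "is_extension G H E" "C = ext_class G H E" using elim[OF CD(1)] by blast
    obtain F :: "('h, 'g) ext" where F: "is_extension G H F" "D = ext_class G H F" using elim[OF CD(2)] by blast
    have "ext_class ?A H (ext_restrict G A E) = ext_class ?A H (ext_restrict G A F)"
      using eq unfolding E(2) F(2) restrict_ext_class[OF G H A E(1)] restrict_ext_class[OF G H A F(1)] .
    then have "ext_equiv H (ext_restrict G A E) (ext_restrict G A F)"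
      by (rule ext_class_eqD[OF tA H res[OF E(1)] res[OF F(1)]])
    then have "ext_equiv H (ext_restrict G A E) F"
      by (rule ext_equiv_trans[OF _ ext_equiv_restrict_self])
    then have "ext_equiv H E F" by (rule ext_equiv_if_restrict[OF assms E(1) F(1)])
    then show "C = D" unfolding E(2) F(2) by (rule ext_class_eqI[OF G H E(1) F(1)])
  qed
  have sur: "carrier (Ext ?A H) \<subseteq> restrict_class G H A ` carrier (Ext G H)"
  proof
    fix C assume "C \<in> carrier (Ext ?A H)"
    then obtain F :: "('h, 'g) ext" where F: "is_extension ?A H F" "C = ext_class ?A H F"
      by (auto simp: Ext_def)
    obtain E :: "('h, 'g) ext" where E: "is_extension G H E" "ext_equiv H F E"
      using extension_from_open_subgroup[OF assms F(1)] by blast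
    have "ext_equiv H F (ext_restrict G A E)" by (rule ext_equiv_restrict_universal[OF G A H F(1) E(2)])
    then have "C = restrict_class G H A (ext_class G H E)"
      unfolding F(2) restrict_ext_class[OF G H A E(1)] by (rule ext_class_eqI[OF tA H F(1) res[OF E(1)]])
    then show "C \<in> restrict_class G H A ` carrier (Ext G H)" using ext_class_in_Ext[OF G H E(1)] by blast
  qed
  have "bij_betw (restrict_class G H A) (carrier (Ext G H)) (carrier (Ext ?A H))"
    unfolding bij_betw_def using inj sur hom_carrier[OF hom] by blast
  with hom show ?thesis by (auto simp: is_iso_def iso_def)
qed

end
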